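(* Let $D\subset\mathbb C^3$ be an open set and let $p\in\partial D$. Assume that $D$ has near $p$ a $\mathcal C^1$ defining function $r$ (with non-zero gradient at $p$) which is twice differentiable at $p$. Let $T_p$ be the complex tangent hyperplane at $p$, and assume that the restriction of the (real) Hessian of $r$ at $p$ to some complex line in $T_p$ has two negative eigenvalues. If $S(D)\neq\mathbb C^3$, then there exists a complex line $l$ through $p$ such that: (i) $T_p\setminus l\subset D$ near $p$, $l\subset\partial D$ near $p$, and $S(D)\supset\mathbb C^3\setminus l$; (ii) for every point $b\in\mathbb C^3$ with $b\notin l$ or $b=p$, there exists a two-dimensional complex plane $P_b\subset\mathbb C^3$ containing $p$ and $b$ such that $D\cap P_b$ is non-pseudoconvex (so $p\in S(D)$); on the other hand, for every $b\in l$ with $b\ne p$ there is no such plane $P_b$; (iii) in particular, the Hessian of $r$ at $p$ (and hence the Levi form of $r$ at $p$) vanishes along $l$; therefore the Hessian of $r$ at $p$ restricted to $T_p$ has two negative and two zero eigenvalues, and the Levi form of $r$ at $p$ restricted to $T_p$ has one negative and one zero eigenvalue.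
   Context: A two-dimensional plane in $\mathbb C^n$ is a complex affine subspace of complex dimension $2$. For such a plane $P$, $D\cap P$ is regarded as an open subset of $P\cong\mathbb C^2$; the empty set is regarded as pseudoconvex. For an open set $D\subset\mathbb C^n$, $S(D)$ denotes the set of all $a\in\mathbb C^n$ for which there is a two-dimensional plane $P\ni a$ such that $P\cap D$ is non-pseudoconvex. A defining function $r$ of $D$ near $p$ is a real-valued function on a neighborhood $U$ of $p$ with $D\cap U=\{z\in U: r(z)<0\}$, $\partial D\cap U=\{z\in U:r(z)=0\}$. The complex tangent hyperplane $T_p$ is the complex affine hyperplane $\{z\in\mathbb C^3:\sum_{j=1}^3\frac{\partial r}{\partial z_j}(p)(z_j-p_j)=0\}$. Its direction space is a two-dimensional complex (four-dimensional real) vector space, with the inner product induced from $\mathbb C^3$; the restricted Hessian (a real quadratic form) and restricted Levi form (a Hermitian form, $X\mapsto\sum_{j,k}\frac{\partial^2 r}{\partial z_j\partial\overline z_k}(p)X_j\overline{X_k}$) are considered on this direction space. The restriction of the Hessian to a complex line in $T_p$ is its restriction to the corresponding one-dimensional complex (two-dimensional real) space of direction vectors; two negative eigenvalues means it is negative definite there. A form vanishes along $l$ if the associated quadratic form is zero on every direction vector of $l$. "$A\subset B$ near $p$" means that $A\cap U\subset B$ for some neighborhood $U$ of $p$. *)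

theory Defs
  imports "HOL-Analysis.Analysis"
begin

section \<open>Complex affine subspaces\<close>

text \<open>Complex linear algebra on \<open>complex ^ 'n\<close> is the library's \<open>vec\<close> interpretation (scalar
  multiplication \<open>*s\<close>); unqualified \<open>dim\<close>, \<open>\<bullet>\<close> and Frechet derivatives are the real ones.\<close>

definition complex_affine :: "nat \<Rightarrow> (complex ^ 'n) set \<Rightarrow> bool" where
  "complex_affine k P \<longleftrightarrow> (\<exists>a V. vec.subspace V \<and> vec.dim V = k \<and> P = (\<lambda>v. a + v) ` V)"

abbreviation complex_line :: "(complex ^ 'n) set \<Rightarrow> bool" where
  "complex_line \<equiv> complex_affine 1"

abbreviation complex_plane :: "(complex ^ 'n) set \<Rightarrow> bool" where
  "complex_plane \<equiv> complex_affine 2"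

definition directions :: "(complex ^ 'n) set \<Rightarrow> (complex ^ 'n) set" where
  "directions A = {x - y | x y. x \<in> A \<and> y \<in> A}"

definition subset_near :: "complex ^ 'n \<Rightarrow> (complex ^ 'n) set \<Rightarrow> (complex ^ 'n) set \<Rightarrow> bool" where
  "subset_near p A B \<longleftrightarrow> (\<exists>U. open U \<and> p \<in> U \<and> A \<inter> U \<subseteq> B)"


section \<open>Pseudoconvexity\<close>

text \<open>Continuous plurisubharmonic functions: the sub-mean value inequality on every closed affine
  disc \<open>{z + \<zeta> w. |\<zeta>| \<le> 1}\<close> contained in \<open>D\<close>.\<close>

definition cont_psh_on :: "(complex ^ 'n) set \<Rightarrow> (complex ^ 'n \<Rightarrow> real) \<Rightarrow> bool" where
  "cont_psh_on D u \<longleftrightarrow> continuous_on D u \<and>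
     (\<forall>z w. (\<forall>\<zeta>. norm \<zeta> \<le> 1 \<longrightarrow> z + \<zeta> *s w \<in> D) \<longrightarrow>
        u z \<le> (1 / (2 * pi)) * integral {0..2 * pi} (\<lambda>t. u (z + cis t *s w)))"

text \<open>Existence of a continuous plurisubharmonic exhaustion function. No connectedness or
  boundedness is required; the empty set and the whole space are pseudoconvex.\<close>

definition pseudoconvex :: "(complex ^ 'n) set \<Rightarrow> bool" where
  "pseudoconvex D \<longleftrightarrow> open D \<and>
     (\<exists>u. cont_psh_on D u \<and> (\<forall>c. compact {z \<in> D. u z \<le> c}))"

text \<open>For a plane \<open>P\<close>, pseudoconvexity of an open subset of \<open>P\<close> is read off in a complex affine
  chart from \<open>complex ^ 2\<close> onto \<open>P\<close>. Every plane has a chart and the choice of the chart does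
  not matter; see \<open>plane_chart_exists\<close> and \<open>pseudoconvex_in_plane_iff\<close> below.\<close>

definition plane_chart :: "(complex ^ 2 \<Rightarrow> complex ^ 'n) \<Rightarrow> (complex ^ 'n) set \<Rightarrow> bool" where
  "plane_chart \<phi> P \<longleftrightarrow> bij_betw \<phi> UNIV P \<and> (\<exists>a A. \<forall>z. \<phi> z = a + A *v z)"

definition pseudoconvex_in_plane :: "(complex ^ 'n) set \<Rightarrow> (complex ^ 'n) set \<Rightarrow> bool" where
  "pseudoconvex_in_plane P E \<longleftrightarrow> (\<exists>\<phi>. plane_chart \<phi> P \<and> pseudoconvex (\<phi> -` E))"

definition S :: "(complex ^ 'n) set \<Rightarrow> (complex ^ 'n) set" where
  "S D = {a. \<exists>P. complex_plane P \<and> a \<in> P \<and> \<not> pseudoconvex_in_plane P (P \<inter> D)}"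


section \<open>Derivatives of defining functions\<close>

definition C1_on :: "(complex ^ 'n) set \<Rightarrow> (complex ^ 'n \<Rightarrow> real) \<Rightarrow> bool" where
  "C1_on U r \<longleftrightarrow> (\<forall>z\<in>U. r differentiable (at z)) \<and>
     (\<forall>v. continuous_on U (\<lambda>z. frechet_derivative r (at z) v))"

text \<open>To be used for \<open>r\<close> differentiable near \<open>p\<close>: all first-order directional derivatives, hence
  the derivative itself, are (Frechet) differentiable at \<open>p\<close>.\<close>

definition twice_differentiable_at :: "(complex ^ 'n \<Rightarrow> real) \<Rightarrow> complex ^ 'n \<Rightarrow> bool" where
  "twice_differentiable_at r p \<longleftrightarrow>
     (\<forall>v. (\<lambda>z. frechet_derivative r (at z) v) differentiable (at p))"

definition C1_defining_function ::
  "(complex ^ 'n \<Rightarrow> real) \<Rightarrow> (complex ^ 'n) set \<Rightarrow> (complex ^ 'n) set \<Rightarrow> bool" where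
  "C1_defining_function r U D \<longleftrightarrow> open U \<and> C1_on U r \<and>
     D \<inter> U = {z \<in> U. r z < 0} \<and> frontier D \<inter> U = {z \<in> U. r z = 0}"

definition hessian :: "(complex ^ 'n \<Rightarrow> real) \<Rightarrow> complex ^ 'n \<Rightarrow> complex ^ 'n \<Rightarrow> complex ^ 'n \<Rightarrow> real" where
  "hessian r p X Y = frechet_derivative (\<lambda>z. frechet_derivative r (at z) Y) (at p) X"

text \<open>Wirtinger derivatives \<open>\<partial>/\<partial>z\<^sub>j = (\<partial>/\<partial>x\<^sub>j - \<i> \<partial>/\<partial>y\<^sub>j) / 2\<close> and
  \<open>\<partial>/\<partial>z\<^sub>j-bar = (\<partial>/\<partial>x\<^sub>j + \<i> \<partial>/\<partial>y\<^sub>j) / 2\<close>.\<close>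

definition wirtinger :: "'n \<Rightarrow> (complex ^ 'n \<Rightarrow> complex) \<Rightarrow> complex ^ 'n \<Rightarrow> complex" where
  "wirtinger j f z = (frechet_derivative f (at z) (axis j 1)
                      - \<i> * frechet_derivative f (at z) (axis j \<i>)) / 2"

definition wirtinger_bar :: "'n \<Rightarrow> (complex ^ 'n \<Rightarrow> complex) \<Rightarrow> complex ^ 'n \<Rightarrow> complex" where
  "wirtinger_bar j f z = (frechet_derivative f (at z) (axis j 1)
                          + \<i> * frechet_derivative f (at z) (axis j \<i>)) / 2"

definition levi :: "(complex ^ 'n \<Rightarrow> real) \<Rightarrow> complex ^ 'n \<Rightarrow> complex ^ 'n \<Rightarrow> complex ^ 'n \<Rightarrow> complex" where
  "levi r p X Y = (\<Sum>j\<in>UNIV. \<Sum>k\<in>UNIV.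
     wirtinger j (wirtinger_bar k (\<lambda>z. of_real (r z))) p * X $ j * cnj (Y $ k))"

definition complex_tangent :: "(complex ^ 'n \<Rightarrow> real) \<Rightarrow> complex ^ 'n \<Rightarrow> (complex ^ 'n) set" where
  "complex_tangent r p =
     {z. (\<Sum>j\<in>UNIV. wirtinger j (\<lambda>z. of_real (r z)) p * (z $ j - p $ j)) = 0}"


section \<open>Eigenvalues of restricted forms\<close>

text \<open>Eigenvectors of the restriction of \<open>B\<close> to a real subspace \<open>V\<close>, with respect to the inner
  product induced on \<open>V\<close>. Eigenvalues are counted with multiplicity.\<close>

definition real_eigenspace ::
  "(complex ^ 'n \<Rightarrow> complex ^ 'n \<Rightarrow> real) \<Rightarrow> (complex ^ 'n) set \<Rightarrow> real \<Rightarrow> (complex ^ 'n) set" where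
  "real_eigenspace B V \<mu> = {x \<in> V. \<forall>y\<in>V. B x y = \<mu> * (x \<bullet> y)}"

definition num_neg_eigenvalues ::
  "(complex ^ 'n \<Rightarrow> complex ^ 'n \<Rightarrow> real) \<Rightarrow> (complex ^ 'n) set \<Rightarrow> nat" where
  "num_neg_eigenvalues B V =
     (\<Sum>\<mu> | \<mu> < 0 \<and> real_eigenspace B V \<mu> \<noteq> {0}. dim (real_eigenspace B V \<mu>))"

definition num_zero_eigenvalues ::
  "(complex ^ 'n \<Rightarrow> complex ^ 'n \<Rightarrow> real) \<Rightarrow> (complex ^ 'n) set \<Rightarrow> nat" where
  "num_zero_eigenvalues B V = dim (real_eigenspace B V 0)"

text \<open>The same for a Hermitian form on a complex subspace (eigenvalues are real, multiplicities
  are complex dimensions).\<close>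

definition herm_eigenspace ::
  "(complex ^ 'n \<Rightarrow> complex ^ 'n \<Rightarrow> complex) \<Rightarrow> (complex ^ 'n) set \<Rightarrow> real \<Rightarrow> (complex ^ 'n) set" where
  "herm_eigenspace L V \<mu> =
     {x \<in> V. \<forall>y\<in>V. L x y = of_real \<mu> * (\<Sum>j\<in>UNIV. x $ j * cnj (y $ j))}"

definition num_neg_herm_eigenvalues ::
  "(complex ^ 'n \<Rightarrow> complex ^ 'n \<Rightarrow> complex) \<Rightarrow> (complex ^ 'n) set \<Rightarrow> nat" where
  "num_neg_herm_eigenvalues L V =
     (\<Sum>\<mu> | \<mu> < 0 \<and> herm_eigenspace L V \<mu> \<noteq> {0}. vec.dim (herm_eigenspace L V \<mu>))"

definition num_zero_herm_eigenvalues ::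
  "(complex ^ 'n \<Rightarrow> complex ^ 'n \<Rightarrow> complex) \<Rightarrow> (complex ^ 'n) set \<Rightarrow> nat" where
  "num_zero_herm_eigenvalues L V = vec.dim (herm_eigenspace L V 0)"


section \<open>Charts of planes\<close>

lemma plane_chart_exists:
  fixes P :: "(complex ^ 'n) set"
  assumes "complex_plane P"
  shows "\<exists>\<phi>. plane_chart \<phi> P"
proof -
  obtain a V where V: "vec.subspace V" "vec.dim V = 2" "P = (\<lambda>v. a + v) ` V"
    using assms by (auto simp: complex_affine_def)
  have "vec.dim (UNIV :: (complex^2) set) = vec.dim V"
    using V by (simp add: vec_dim_card del: vec.dim_UNIV)
  then obtain f :: "complex^2 \<Rightarrow> complex^'n"
    where f: "Vector_Spaces.linear (*s) (*s) f" "f ` UNIV = V" "inj f"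
    using vec.subspace_isomorphism[of UNIV V] V(1) vec.subspace_UNIV by blast
  have "f z = matrix f *v z" for z
    using matrix_works f(1) by metis
  moreover have "bij_betw (\<lambda>z. a + f z) UNIV P"
    using f V by (auto simp: bij_betw_def inj_def)
  ultimately have "plane_chart (\<lambda>z. a + f z) P"
    unfolding plane_chart_def
    by (intro conjI exI[of _ a] exI[of _ "matrix f"] allI) simp_all
  then show ?thesis
    by (rule exI[of "\<lambda>\<phi>. plane_chart \<phi> P"])
qed

lemma continuous_on_matrix_vector_mult_complex:
  fixes A :: "complex ^ 'm ^ 'n"
  shows "continuous_on X (\<lambda>z. A *v z)"
  unfolding matrix_vector_mult_def by (intro continuous_intros)

lemma pseudoconvex_affine_vimage:
  fixes h k :: "complex ^ 'n \<Rightarrow> complex ^ 'n"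
  assumes D: "pseudoconvex D"
    and h: "\<And>z. h z = b + B *v z" and k: "\<And>z. k z = c + C *v z"
    and hk: "\<And>z. h (k z) = z" "\<And>z. k (h z) = z"
  shows "pseudoconvex (h -` D)"
proof -
  have ch: "continuous_on X h" and ck: "continuous_on X k" for X
    unfolding h k by (intro continuous_intros continuous_on_matrix_vector_mult_complex)+
  obtain u where u: "open D" "cont_psh_on D u" "\<And>c. compact {z \<in> D. u z \<le> c}"
    using D by (auto simp: pseudoconvex_def)
  have aff: "h (z + \<zeta> *s w) = h z + \<zeta> *s (B *v w)" for z w \<zeta>
    by (simp add: h matrix_vector_right_distrib vector_scalar_commute)
  have "open (h -` D)"
    using open_vimage[OF u(1) ch] .
  moreover have "cont_psh_on (h -` D) (u \<circ> h)"
    unfolding cont_psh_on_def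
  proof (intro conjI allI impI)
    show "continuous_on (h -` D) (u \<circ> h)"
      using u(2) by (intro continuous_on_compose ch)
        (auto simp: cont_psh_on_def intro: continuous_on_subset)
  next
    fix z w assume "\<forall>\<zeta>. norm \<zeta> \<le> 1 \<longrightarrow> z + \<zeta> *s w \<in> h -` D"
    then have "\<forall>\<zeta>. norm \<zeta> \<le> 1 \<longrightarrow> h z + \<zeta> *s (B *v w) \<in> D"
      by (simp add: aff)
    with u(2) show "(u \<circ> h) z \<le> 1 / (2 * pi) * integral {0..2 * pi} (\<lambda>t. (u \<circ> h) (z + cis t *s w))"
      unfolding cont_psh_on_def by (simp add: aff)
  qed
  moreover have "compact {z \<in> h -` D. (u \<circ> h) z \<le> c}" for c
  proof -
    have "{z \<in> h -` D. (u \<circ> h) z \<le> c} = k ` {z \<in> D. u z \<le> c}"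
      using hk by (auto simp: image_iff) metis
    then show ?thesis
      using compact_continuous_image[OF ck u(3)] by simp
  qed
  ultimately show ?thesis
    unfolding pseudoconvex_def by blast
qed

lemma plane_chart_transition:
  fixes \<phi> \<psi> :: "complex ^ 2 \<Rightarrow> complex ^ 'n"
  assumes "plane_chart \<phi> P" "plane_chart \<psi> P"
  shows "\<exists>h b B. (\<forall>z. h z = b + B *v z) \<and> (\<forall>z. \<phi> (h z) = \<psi> z)"
proof -
  obtain a A where A: "\<And>z. \<phi> z = a + A *v z" using assms by (auto simp: plane_chart_def)
  obtain a' A' where A': "\<And>z. \<psi> z = a' + A' *v z" using assms by (auto simp: plane_chart_def)
  have bij: "inj \<phi>" "range \<phi> = P" "range \<psi> = P"
    using assms by (auto simp: plane_chart_def bij_betw_def)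
  have injA: "inj ((*v) A)" using bij(1) A by (auto simp: inj_def)
  then obtain G where G: "G ** A = mat 1"
    using matrix_left_invertible_injective by blast
  have GA: "G *v (A *v z) = z" for z
    by (simp add: matrix_vector_mul_assoc G)
  have "\<exists>y. \<phi> y = \<psi> z" for z using bij by (metis rangeE rangeI)
  then obtain h where h: "\<And>z. \<phi> (h z) = \<psi> z" by metis
  have "h z = G *v (a' - a) + (G ** A') *v z" for z
  proof -
    have "A *v h z = (a' - a) + A' *v z" using h[of z] A A' by (simp add: algebra_simps)
    then have "G *v (A *v h z) = G *v ((a' - a) + A' *v z)" by simp
    then show ?thesis
      unfolding GA by (simp add: matrix_vector_right_distrib matrix_vector_mul_assoc)
  qed
  with h show ?thesis by blast
qed

lemma pseudoconvex_in_plane_iff: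
  fixes \<phi> :: "complex ^ 2 \<Rightarrow> complex ^ 'n"
  assumes \<phi>: "plane_chart \<phi> P"
  shows "pseudoconvex_in_plane P E \<longleftrightarrow> pseudoconvex (\<phi> -` E)"
proof
  assume "pseudoconvex_in_plane P E"
  then obtain \<psi> where \<psi>: "plane_chart \<psi> P" "pseudoconvex (\<psi> -` E)"
    by (auto simp: pseudoconvex_in_plane_def)
  obtain h b B where h: "\<And>z. h z = b + B *v z" "\<And>z. \<psi> (h z) = \<phi> z"
    using plane_chart_transition[OF \<psi>(1) \<phi>] by blast
  obtain k c C where k: "\<And>z. k z = c + C *v z" "\<And>z. \<phi> (k z) = \<psi> z"
    using plane_chart_transition[OF \<phi> \<psi>(1)] by blast
  have inj: "inj \<phi>" "inj \<psi>" using \<phi> \<psi> by (auto simp: plane_chart_def bij_betw_def)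
  have "h (k z) = z" "k (h z) = z" for z
    using inj h(2) k(2) by (metis injD)+
  then have "pseudoconvex (h -` (\<psi> -` E))"
    using pseudoconvex_affine_vimage[OF \<psi>(2) h(1) k(1)] by blast
  also have "h -` (\<psi> -` E) = \<phi> -` E" using h(2) by auto
  finally show "pseudoconvex (\<phi> -` E)" .
qed (use \<phi> in \<open>auto simp: pseudoconvex_in_plane_def\<close>)

end

theory Submission
  imports Defs
begin

text \<open>If \<open>v\<close> is a complex tangent direction at \<open>p\<close> whose small punctured disc \<open>p + \<zeta> v\<close> lies in \<open>D\<close>
  (a negative definite Hessian on the line of \<open>v\<close> gives this), then pushing the closed disc inwards
  gives a family of discs in \<open>D\<close> whose limit has its boundary in \<open>D\<close> and its centre \<open>p\<close> outside.
  So every plane through \<open>p\<close> that contains \<open>v\<close> and is transversal to the complex tangent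
  hyperplane meets \<open>D\<close> in a non-pseudoconvex set. Hence a point \<open>a = p + w\<close> outside \<open>S D\<close> is a tangent
  point off the line of \<open>v\<close>. The disc continuity principle in the tangent plane shows that no disc over
  a point of the line \<open>p + \<complex> w\<close> near \<open>p\<close> is contained in \<open>D\<close>; applied to slightly tilted planes
  through \<open>a\<close>, it puts all other nearby tangent points into \<open>D\<close>. So \<open>l\<close> is the line through \<open>p\<close>
  and \<open>a\<close>. At its points \<open>r\<close> is maximal along the tangent hyperplane, so that its directions form the kernel of the
  restricted Hessian.\<close>

section \<open>Continuity principle for affine discs\<close>

text \<open>The obstacle is that \<open>p\<close> is not in \<open>D\<close>: inside the tangent
  hyperplane the disc over \<open>0\<close> in direction \<open>v\<close> has its centre outside
  \<open>D\<close>, so the continuity principle has no disc to start from. The tilt provides one,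
  but the plane must still pass through \<open>a\<close>. A slope along \<open>w\<close> lowers the
  disc over \<open>0\<close>; since \<open>a\<close> stays fixed, the nearby discs are lowered by
  almost the same amount. A second slope, along \<open>v\<close>, has to lift one prescribed point
  of the disc back above the tangent hyperplane while staying weaker than the lowering near the
  centre. Both slopes are complex linear, so heights are complex multiples of \<open>n\<close>;
  hence \<open>r\<close> has to increase in a whole cone about \<open>n\<close> and not only along
  the real ray. As \<open>r\<close> is merely C1 near \<open>p\<close>, there is no second order
  expansion at other points. In the geometric argument the Hessian serves only to produce the
  punctured disc in \<open>D\<close>; it returns at the end as the derivative at \<open>p\<close> of
  the first derivative along \<open>l\<close>.\<close>

lemma continuous_on_vsmult [continuous_intros]:
  fixes g :: "'a::topological_space \<Rightarrow> complex ^ 'n"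
  assumes "continuous_on X f" "continuous_on X g"
  shows "continuous_on X (\<lambda>x. f x *s g x)"
  unfolding vector_scalar_mult_def using assms by (intro continuous_intros)

text \<open>Maximum principle on a closed disc. An interior maximum is refuted at a maximum point of
  largest modulus: the largest disc about it inside the unit disc touches the unit circle at a point
  where the maximum is not attained, and by continuity the mean is strictly too small.\<close>

lemma cont_psh_on_disc_le:
  fixes G :: "(complex ^ 'n) set"
  assumes u: "cont_psh_on G u"
    and disc: "\<And>\<zeta>. norm \<zeta> \<le> 1 \<Longrightarrow> z + \<zeta> *s w \<in> G"
    and bd: "\<And>\<zeta>. norm \<zeta> = 1 \<Longrightarrow> u (z + \<zeta> *s w) \<le> M"
    and "norm \<zeta> \<le> 1"
  shows "u (z + \<zeta> *s w) \<le> M"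
proof -
  define g where "g = (\<lambda>\<zeta>. u (z + \<zeta> *s w))"
  have cont: "continuous_on (cball 0 1) g"
    unfolding g_def
    by (rule continuous_on_compose2[where g = u and t = G])
      (use u disc in \<open>auto simp: cont_psh_on_def intro!: continuous_intros\<close>)
  obtain \<zeta>1 where \<zeta>1: "\<zeta>1 \<in> cball 0 1" "\<And>\<zeta>. \<zeta> \<in> cball 0 1 \<Longrightarrow> g \<zeta> \<le> g \<zeta>1"
    using continuous_attains_sup[OF compact_cball _ cont] by auto
  define K where "K = cball 0 1 \<inter> g -` {g \<zeta>1}"
  have "closed K"
    unfolding K_def by (rule continuous_closed_preimage[OF cont]) auto
  then have "compact K"
    by (metis K_def Int_lower1 bounded_cball bounded_subset compact_eq_bounded_closed)
  moreover have "\<zeta>1 \<in> K" using \<zeta>1 by (simp add: K_def)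
  ultimately obtain \<zeta>0 where \<zeta>0: "\<zeta>0 \<in> K" "\<And>\<zeta>. \<zeta> \<in> K \<Longrightarrow> norm \<zeta> \<le> norm \<zeta>0"
    using continuous_attains_sup[of K norm] by (auto intro: continuous_intros)
  have "norm \<zeta>0 = 1"
  proof (rule ccontr)
    assume "norm \<zeta>0 \<noteq> 1"
    define \<rho> where "\<rho> = 1 - norm \<zeta>0"
    have "\<rho> > 0" using \<zeta>0(1) \<open>norm \<zeta>0 \<noteq> 1\<close> by (simp add: \<rho>_def K_def)
    have inb: "\<zeta>0 + \<xi> * \<rho> \<in> cball 0 1" if "norm \<xi> \<le> 1" for \<xi> :: complex
    proof -
      have "norm (\<zeta>0 + \<xi> * \<rho>) \<le> norm \<zeta>0 + norm \<xi> * \<rho>"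
        using norm_triangle_ineq[of \<zeta>0 "\<xi> * \<rho>"] \<open>\<rho> > 0\<close> by (simp add: norm_mult)
      also have "\<dots> \<le> norm \<zeta>0 + 1 * \<rho>" using that \<open>\<rho> > 0\<close> by (intro add_left_mono mult_right_mono) auto
      finally show ?thesis by (simp add: \<rho>_def)
    qed
    have eq: "z + \<zeta>0 *s w + \<xi> *s (of_real \<rho> *s w) = z + (\<zeta>0 + \<xi> * \<rho>) *s w" for \<xi>
      by (simp add: vector_sadd_rdistrib vector_smult_assoc add.assoc)
    have "\<forall>\<xi>. norm \<xi> \<le> 1 \<longrightarrow> z + \<zeta>0 *s w + \<xi> *s (of_real \<rho> *s w) \<in> G"
      unfolding eq using inb disc by (metis dist_0_norm mem_cball)
    then have "g \<zeta>0 \<le> 1 / (2 * pi) * integral {0..2 * pi} (\<lambda>t. u (z + \<zeta>0 *s w + cis t *s (of_real \<rho> *s w)))"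
      using u unfolding cont_psh_on_def g_def by blast
    then have mean: "g \<zeta>0 * (2 * pi) \<le> integral {0..2 * pi} (\<lambda>t. g (\<zeta>0 + cis t * \<rho>))"
      unfolding eq by (simp add: g_def field_simps)
    \<comment> \<open>The angle of the point of tangency. For \<open>\<zeta>0 = 0\<close> any angle
      would do, and the polar identity below still holds.\<close>
    define t0 where "t0 = Arg2pi \<zeta>0"
    have t0: "t0 \<in> {0..2 * pi}" using Arg2pi[of \<zeta>0] by (auto simp: t0_def)
    have "\<zeta>0 = of_real (norm \<zeta>0) * cis t0" using Arg2pi_eq[of \<zeta>0] by (simp add: t0_def cis_conv_exp)
    then have "\<zeta>0 + cis t0 * \<rho> = of_real (norm \<zeta>0) * cis t0 + cis t0 * \<rho>" by simp
    also have "\<dots> = cis t0" by (simp add: \<rho>_def algebra_simps)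
    finally have pt: "\<zeta>0 + cis t0 * \<rho> = cis t0" .
    have "cis t0 \<notin> K" using \<zeta>0(2)[of "cis t0"] \<open>\<rho> > 0\<close> by (auto simp: \<rho>_def)
    then have "g (cis t0) \<noteq> g \<zeta>1" by (simp add: K_def)
    then have lt: "g (\<zeta>0 + cis t0 * \<rho>) < g \<zeta>1" using \<zeta>1(2)[of "cis t0"] pt by simp
    have cc: "continuous_on {0..2 * pi} (\<lambda>t. g (\<zeta>0 + cis t * \<rho>))"
      by (rule continuous_on_compose2[OF cont]) (use inb in \<open>auto intro!: continuous_intros simp: continuous_on_cis\<close>)
    have "integral {0..2 * pi} (\<lambda>t. g (\<zeta>0 + cis t * \<rho>)) < integral {0..2 * pi} (\<lambda>t. g \<zeta>1)"
    proof (rule ccontr)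
      assume not_less: "\<not> ?thesis"
      let ?h = "\<lambda>t. g \<zeta>1 - g (\<zeta>0 + cis t * \<rho>)"
      have ch: "continuous_on {0..2 * pi} ?h" by (intro continuous_intros cc)
      have nn: "?h t \<ge> 0" for t using \<zeta>1(2) inb[of "cis t"] by simp
      have "integral {0..2 * pi} ?h = integral {0..2 * pi} (\<lambda>t. g \<zeta>1) - integral {0..2 * pi} (\<lambda>t. g (\<zeta>0 + cis t * \<rho>))"
        by (intro integral_diff integrable_continuous_real cc continuous_intros)
      then have "integral {0..2 * pi} ?h \<le> 0" using not_less by simp
      moreover have "integral {0..2 * pi} ?h \<ge> 0"
        by (intro integral_nonneg integrable_continuous_real ch nn)
      ultimately have "integral {0..2 * pi} ?h = 0" by simp
      then have "?h t0 = 0" using integral_eq_0_iff[OF ch] nn t0 by simp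
      with lt show False by simp
    qed
    then show False using mean \<zeta>0(1) by (simp add: K_def mult.commute)
  qed
  then have "g \<zeta>0 \<le> M" using bd by (simp add: g_def)
  moreover have "g \<zeta> \<le> g \<zeta>0" using \<zeta>1(2)[of \<zeta>] \<zeta>0(1) \<open>norm \<zeta> \<le> 1\<close> by (simp add: K_def)
  ultimately show ?thesis by (simp add: g_def)
qed

text \<open>The parameters whose whole disc lies in \<open>G\<close> form a clopen part of
  \<open>C\<close>. Openness is compactness of the closed disc. For closedness, the maximum
  principle carries a bound of the exhaustion function from the boundary circles to the discs, and a
  compact sublevel set cannot lose the limit disc.\<close>

lemma pseudoconvex_disc_continuity:
  fixes c :: "'a::euclidean_space \<Rightarrow> complex ^ 'n"
  assumes G: "pseudoconvex G" and C: "connected C" and c: "continuous_on C c"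
    and bd: "\<And>\<tau> \<zeta>. \<tau> \<in> C \<Longrightarrow> norm \<zeta> = 1 \<Longrightarrow> c \<tau> + \<zeta> *s w \<in> G"
    and \<tau>0: "\<tau>0 \<in> C" and disc: "\<And>\<zeta>. norm \<zeta> \<le> 1 \<Longrightarrow> c \<tau>0 + \<zeta> *s w \<in> G"
    and "\<tau> \<in> C" "norm \<zeta> \<le> 1"
  shows "c \<tau> + \<zeta> *s w \<in> G"
proof -
  obtain u where u: "open G" "cont_psh_on G u" "\<And>M. compact {z \<in> G. u z \<le> M}"
    using G by (auto simp: pseudoconvex_def)
  define N where "N = {\<tau> \<in> C. \<forall>\<zeta>. norm \<zeta> \<le> 1 \<longrightarrow> c \<tau> + \<zeta> *s w \<in> G}"
  define f where "f = (\<lambda>(\<zeta>, \<tau>). c \<tau> + \<zeta> *s w)"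
  have cf: "continuous_on (X \<times> C) f" for X
    unfolding f_def case_prod_unfold
    by (intro continuous_intros continuous_on_compose2[OF c]) auto
  have "openin (top_of_set C) N"
  proof -
    \<comment> \<open>The bad parameters are the projection of a closed set along the compact
      disc.\<close>
    have "closedin (top_of_set (cball 0 1 \<times> C)) ((cball 0 1 \<times> C) \<inter> f -` (- G))"
      by (intro continuous_closedin_preimage cf) (use u(1) in auto)
    then have "closedin (top_of_set C) {\<tau>. \<exists>\<zeta>. \<zeta> \<in> cball 0 1 \<and> (\<zeta>, \<tau>) \<in> (cball 0 1 \<times> C) \<inter> f -` (- G)}"
      by (rule closedin_compact_projection[OF compact_cball])
    moreover have "{\<tau>. \<exists>\<zeta>. \<zeta> \<in> cball 0 1 \<and> (\<zeta>, \<tau>) \<in> (cball 0 1 \<times> C) \<inter> f -` (- G)} = C - N"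
      by (auto simp: N_def f_def)
    ultimately show ?thesis by (simp add: openin_closedin_eq N_def) 
  qed
  moreover have "closedin (top_of_set C) N"
    unfolding closedin_limpt
  proof (intro conjI allI impI)
    show "N \<subseteq> C" by (auto simp: N_def)
    fix l assume "l islimpt N \<and> l \<in> C"
    then obtain s where l: "l \<in> C" "\<And>n. s n \<in> N" "s \<longlonglongrightarrow> l"
      unfolding islimpt_sequential by auto
    \<comment> \<open>With the limit added, the boundary circles over \<open>Q\<close> form one
      compact subset of \<open>G\<close>, so a single bound \<open>M\<close> of \<open>u\<close>
      serves all discs of the sequence.\<close>
    define Q where "Q = insert l (range s)"
    have Q: "compact Q" "Q \<subseteq> C"
      using compact_sequence_with_limit[OF l(3)] l by (auto simp: Q_def N_def)
    have Kc: "compact (f ` (sphere 0 1 \<times> Q))"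
      using Q by (intro compact_continuous_image compact_Times compact_sphere continuous_on_subset[OF cf[of "sphere 0 1"]]) auto
    have KG: "f ` (sphere 0 1 \<times> Q) \<subseteq> G" using bd Q(2) by (auto simp: f_def)
    have "bounded (u ` (f ` (sphere 0 1 \<times> Q)))"
      using u(2) Kc KG unfolding cont_psh_on_def
      by (meson compact_continuous_image compact_imp_bounded continuous_on_subset)
    then obtain M where M: "\<And>x. x \<in> f ` (sphere 0 1 \<times> Q) \<Longrightarrow> u x \<le> M"
      unfolding bounded_iff by (metis abs_le_D1 image_eqI real_norm_def)
    have le: "u (c (s n) + \<zeta> *s w) \<le> M" if "norm \<zeta> \<le> 1" for n \<zeta>
    proof (rule cont_psh_on_disc_le[OF u(2) _ _ that])
      show "c (s n) + \<zeta> *s w \<in> G" if "norm \<zeta> \<le> 1" for \<zeta>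
        using l(2)[of n] that by (auto simp: N_def)
      show "u (c (s n) + \<zeta> *s w) \<le> M" if "norm \<zeta> = 1" for \<zeta>
        by (rule M) (use that in \<open>auto simp: f_def Q_def image_iff intro!: bexI[of _ "(\<zeta>, s n)"]\<close>)
    qed
    have "c l + \<zeta> *s w \<in> G" if "norm \<zeta> \<le> 1" for \<zeta>
    proof -
      have "(\<lambda>n. c (s n)) \<longlonglongrightarrow> c l"
        using c l unfolding continuous_on_sequentially N_def comp_def by auto
      then have lim: "(\<lambda>n. c (s n) + \<zeta> *s w) \<longlonglongrightarrow> c l + \<zeta> *s w" by (intro tendsto_intros)
      have mem: "c (s n) + \<zeta> *s w \<in> {z \<in> G. u z \<le> M}" for n
        using le that l(2)[of n] by (auto simp: N_def)
      have "c l + \<zeta> *s w \<in> {z \<in> G. u z \<le> M}"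
        by (rule closed_sequentially[OF compact_imp_closed[OF u(3)] mem lim])
      then show ?thesis by simp
    qed
    then show "l \<in> N" using l(1) by (simp add: N_def)
  qed
  moreover have "\<tau>0 \<in> N" using \<tau>0 disc by (simp add: N_def)
  ultimately have "N = C" using C unfolding connected_clopen by blast
  then show ?thesis using assms(7,8) by (auto simp: N_def)
qed

text \<open>A left inverse of the matrix of a chart turns discs in \<open>P\<close> into affine
  discs of \<open>complex ^ 2\<close>. With this form all later arguments take place in the ambient
  space, without charts.\<close>

lemma pseudoconvex_in_plane_disc_continuity:
  fixes c :: "'a::euclidean_space \<Rightarrow> complex ^ 'n"
  assumes psc: "pseudoconvex_in_plane P (P \<inter> D)"
    and C: "connected C" and c: "continuous_on C c"
    and P: "\<And>\<tau> \<zeta>. \<tau> \<in> C \<Longrightarrow> c \<tau> + \<zeta> *s w \<in> P"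
    and bd: "\<And>\<tau> \<zeta>. \<tau> \<in> C \<Longrightarrow> norm \<zeta> = 1 \<Longrightarrow> c \<tau> + \<zeta> *s w \<in> D"
    and \<tau>0: "\<tau>0 \<in> C" and disc: "\<And>\<zeta>. norm \<zeta> \<le> 1 \<Longrightarrow> c \<tau>0 + \<zeta> *s w \<in> D"
    and "\<tau> \<in> C" "norm \<zeta> \<le> 1"
  shows "c \<tau> + \<zeta> *s w \<in> D"
proof -
  obtain \<phi> :: "complex ^ 2 \<Rightarrow> complex ^ 'n" where \<phi>: "plane_chart \<phi> P" "pseudoconvex (\<phi> -` (P \<inter> D))"
    using psc by (auto simp: pseudoconvex_in_plane_def)
  then obtain a A where A: "\<And>z. \<phi> z = a + A *v z" by (auto simp: plane_chart_def)
  have bij: "inj \<phi>" "range \<phi> = P" using \<phi>(1) by (auto simp: plane_chart_def bij_betw_def)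
  have "inj ((*v) A)" using bij(1) A by (auto simp: inj_def)
  then obtain B where B: "B ** A = mat 1"
    using matrix_left_invertible_injective by blast
  have \<phi>B: "\<phi> (B *v (x - a)) = x" if "x \<in> P" for x
  proof -
    have "x \<in> range \<phi>" using that bij(2) by simp
    then obtain z where "x = \<phi> z" by (rule rangeE)
    then show ?thesis by (simp add: A matrix_vector_mul_assoc B)
  qed
  define c' where "c' = (\<lambda>\<tau>. B *v (c \<tau> - a))"
  have eq: "\<phi> (c' \<tau> + \<zeta> *s (B *v w)) = c \<tau> + \<zeta> *s w" if "\<tau> \<in> C" for \<tau> \<zeta>
  proof -
    have "c' \<tau> + \<zeta> *s (B *v w) = B *v ((c \<tau> + \<zeta> *s w) - a)"
      by (simp add: c'_def matrix_vector_mult_diff_distrib matrix_vector_right_distrib vector_scalar_commute)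
    then show ?thesis using \<phi>B[OF P[OF that]] by simp
  qed
  have "c' \<tau> + \<zeta> *s (B *v w) \<in> \<phi> -` (P \<inter> D)"
  proof (rule pseudoconvex_disc_continuity[OF \<phi>(2) C _ _ \<tau>0 _ assms(8,9)])
    show "continuous_on C c'" unfolding c'_def
      by (rule continuous_on_compose2[OF continuous_on_matrix_vector_mult_complex[of UNIV]]) (intro continuous_intros c, simp)
  qed (use eq P bd disc \<tau>0 in auto)
  then show ?thesis using eq[OF assms(8)] by simp
qed

lemma vec_span_pair:
  fixes x y :: "complex ^ 'n"
  shows "vec.span {x, y} = {s *s x + t *s y | s t. True}"
proof -
  have "z \<in> vec.span {x, y} \<longleftrightarrow> (\<exists>s t. z = s *s x + t *s y)" for z
    unfolding vec.span_insert vec.span_singleton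
    by (auto simp: image_iff) (metis add.commute diff_add_cancel add_diff_cancel_left')+
  then show ?thesis by auto
qed

lemma vec_independent_pair:
  fixes x y :: "complex ^ 'n"
  assumes "\<And>s t. s *s x + t *s y = 0 \<Longrightarrow> s = 0 \<and> t = 0"
  shows "vec.independent {x, y}" "card {x, y} = 2"
proof -
  have "y \<noteq> 0" using assms[of 0 1] by auto
  have "x \<notin> vec.span {y}"
  proof
    assume "x \<in> vec.span {y}"
    then obtain t where "x = t *s y" by (auto simp: vec.span_singleton)
    then have "1 *s x + (- t) *s y = 0" by (simp add: vector_smult_lneg)
    then show False using assms by fastforce
  qed
  then show "vec.independent {x, y}" using \<open>y \<noteq> 0\<close>
    by (simp add: vec.independent_insert vec.dependent_single)
  have "x \<noteq> y" using assms[of 1 "-1"] by (auto simp: vector_smult_lneg)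
  then show "card {x, y} = 2" by simp
qed

lemma complex_plane_span:
  fixes x y :: "complex ^ 'n"
  assumes "\<And>s t. s *s x + t *s y = 0 \<Longrightarrow> s = 0 \<and> t = 0"
  shows "complex_plane {a + s *s x + t *s y | s t. True}"
proof -
  have "{a + s *s x + t *s y | s t. True} = (\<lambda>v. a + v) ` vec.span {x, y}"
    unfolding vec_span_pair by (auto simp: image_iff add.assoc) 
  then show ?thesis
    unfolding complex_affine_def
    using vec_independent_pair[OF assms] vec.subspace_span vec.dim_span_eq_card_independent by metis
qed

section \<open>Discs at a boundary point\<close>

lemma scaleR_eq_vsmult: "t *\<^sub>R x = of_real t *s (x :: complex ^ 'n)"
  unfolding vec_eq_iff by simp (simp add: scaleR_conv_of_real)

lemma norm_vsmult: "norm (c *s x) = norm c * norm (x :: complex ^ 'n)"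
  by (simp add: norm_vec_def norm_mult L2_set_right_distrib)

lemma vsmult_split: "c *s x = Re c *\<^sub>R x + Im c *\<^sub>R (\<i> *s (x :: complex ^ 'n))"
  by (simp add: vec_eq_iff complex_eq_iff)

lemma segment_mvt:
  fixes r :: "'a::real_normed_vector \<Rightarrow> real"
  assumes "\<And>t. 0 \<le> t \<Longrightarrow> t \<le> 1 \<Longrightarrow> r differentiable (at (x + t *\<^sub>R h))"
  obtains t where "0 < t" "t < 1" "r (x + h) - r x = frechet_derivative r (at (x + t *\<^sub>R h)) h"
proof -
  have "((\<lambda>t. r (x + t *\<^sub>R h)) has_derivative
      (\<lambda>s. frechet_derivative r (at (x + t *\<^sub>R h)) (s *\<^sub>R h))) (at t within {0..1})"
    if "0 \<le> t" "t \<le> 1" for t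
  proof -
    have "((\<lambda>t. x + t *\<^sub>R h) has_derivative (\<lambda>s. s *\<^sub>R h)) (at t within {0..1})"
      by (auto intro!: derivative_eq_intros)
    then show ?thesis
      using has_derivative_compose assms[OF that] frechet_derivative_works by blast
  qed
  then have "\<exists>t\<in>{0<..<1}. r (x + 1 *\<^sub>R h) - r (x + 0 *\<^sub>R h) =
      frechet_derivative r (at (x + t *\<^sub>R h)) ((1 - 0) *\<^sub>R h)"
    by (intro mvt_simple[where f = "\<lambda>t. r (x + t *\<^sub>R h)"]) simp_all
  then show thesis using that by auto
qed

locale boundary_point =
  fixes D U :: "(complex ^ 'n) set" and p :: "complex ^ 'n" and r :: "complex ^ 'n \<Rightarrow> real"
  assumes open_D: "open D" and p_frontier: "p \<in> frontier D"
    and p_U: "p \<in> U" and defining: "C1_defining_function r U D"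
    and gradient: "frechet_derivative r (at p) \<noteq> (\<lambda>v. 0)"
begin

text \<open>Twice the complex linear part of the derivative of \<open>r\<close> at \<open>p\<close>, so that the derivative itself
  is \<open>Re dc\<close>.\<close>

definition dc :: "complex ^ 'n \<Rightarrow> complex" where
  "dc x = of_real (frechet_derivative r (at p) x) - \<i> * of_real (frechet_derivative r (at p) (\<i> *s x))"

lemma open_U: "open U" and diff_U: "z \<in> U \<Longrightarrow> r differentiable (at z)"
  and cont_U: "continuous_on U (\<lambda>z. frechet_derivative r (at z) v)"
  and mem_D_iff: "z \<in> U \<Longrightarrow> z \<in> D \<longleftrightarrow> r z < 0"
  and frontier_D_iff: "z \<in> U \<Longrightarrow> z \<in> frontier D \<longleftrightarrow> r z = 0"
  using defining by (auto simp: C1_defining_function_def C1_on_def)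

lemma p_notin_D: "p \<notin> D"
  using p_frontier open_D by (simp add: frontier_def interior_open)

lemma r_p: "r p = 0"
  using frontier_D_iff p_U p_frontier by blast

lemma linear_dr: "z \<in> U \<Longrightarrow> linear (frechet_derivative r (at z))"
  by (intro linear_frechet_derivative diff_U)

lemma dr_vsmult:
  assumes "z \<in> U"
  shows "frechet_derivative r (at z) (c *s x) =
    Re c * frechet_derivative r (at z) x + Im c * frechet_derivative r (at z) (\<i> *s x)"
  by (subst vsmult_split) (simp add: linear_add linear_scale linear_dr[OF assms])

lemma dc_add: "dc (x + y) = dc x + dc y"
  by (simp add: dc_def linear_add linear_dr p_U vector_add_ldistrib algebra_simps)

lemma dc_vsmult: "dc (c *s x) = c * dc x"
proof -
  have "frechet_derivative r (at p) (\<i> *s (c *s x)) = frechet_derivative r (at p) ((\<i> * c) *s x)"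
    by (simp add: vector_smult_assoc)
  then show ?thesis
    using dr_vsmult[OF p_U, of c x] dr_vsmult[OF p_U, of "\<i> * c" x] by (simp add: dc_def complex_eq_iff)
qed

lemma dc_diff: "dc (x - y) = dc x - dc y"
  using dc_add[of "x - y" y] by simp

lemma dc_0: "dc 0 = 0"
  using dc_vsmult[of 0 0] by simp

lemma dc_sum: "finite A \<Longrightarrow> dc (\<Sum>i\<in>A. f i) = (\<Sum>i\<in>A. dc (f i))"
  by (induction rule: finite_induct) (auto simp: dc_add dc_0)

lemma dr_eq: "frechet_derivative r (at p) x = Re (dc x)"
  by (simp add: dc_def)

text \<open>The Wirtinger coefficients of \<open>r\<close> are half the values of \<open>dc\<close>
  on the axes, and the factor does not affect the zero set.\<close>

lemma complex_tangent_eq: "complex_tangent r p = {z. dc (z - p) = 0}"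
proof -
  have "((\<lambda>z. complex_of_real (r z)) has_derivative (\<lambda>v. of_real (frechet_derivative r (at p) v))) (at p)"
    using diff_U[OF p_U] unfolding frechet_derivative_works by (rule has_derivative_of_real)
  then have fd: "frechet_derivative (\<lambda>z. complex_of_real (r z)) (at p) = (\<lambda>v. of_real (frechet_derivative r (at p) v))"
    by (metis frechet_derivative_at)
  have ax: "axis j \<i> = \<i> *s (axis j 1 :: complex ^ 'n)" for j
    by (simp add: vec_eq_iff axis_def)
  have "wirtinger j (\<lambda>z. of_real (r z)) p = dc (axis j 1) / 2" for j
    by (simp add: wirtinger_def fd ax dc_def)
  moreover have sum: "(\<Sum>j\<in>UNIV. dc (axis j 1) / 2 * (z $ j - p $ j)) = dc (z - p) / 2" for z
  proof -
    have "dc (z - p) = dc (\<Sum>j\<in>UNIV. (z - p) $ j *s axis j 1)" by (simp only: basis_expansion)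
    also have "\<dots> = (\<Sum>j\<in>UNIV. dc (axis j 1) * (z $ j - p $ j))"
      by (simp only: dc_sum finite dc_vsmult) (simp add: mult.commute)
    finally show ?thesis by (simp add: sum_divide_distrib)
  qed
  ultimately show ?thesis by (simp only: complex_tangent_def sum) simp
qed

text \<open>Complex linearity of \<open>dc\<close> permits rescaling by a complex factor. The
  derivative of \<open>r\<close> at \<open>p\<close> is then 1 along \<open>n\<close> and 0 along
  \<open>\<i> *s n\<close>.\<close>

lemma normal_exists: "\<exists>n. dc n = 1"
proof -
  obtain x where "frechet_derivative r (at p) x \<noteq> 0" using gradient by auto
  then have "dc x \<noteq> 0" by (auto simp: dr_eq)
  then have "dc ((1 / dc x) *s x) = 1" by (simp add: dc_vsmult)
  then show ?thesis ..
qed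

text \<open>By continuity of the first derivatives, near \<open>p\<close> the derivative along
  \<open>n\<close> exceeds 3/4 and the one along \<open>\<i> *s n\<close> is below 1/4 in modulus.
  In a direction \<open>\<zeta> *s n\<close> of the cone the derivative is therefore at least
  \<open>Re \<zeta> / 2\<close>, and the mean value theorem applies.\<close>

lemma increasing_in_normal_cone:
  assumes n: "dc n = 1"
  obtains \<rho> where "\<rho> > 0" "ball p \<rho> \<subseteq> U"
    "\<And>x \<zeta>. x \<in> ball p \<rho> \<Longrightarrow> x + \<zeta> *s n \<in> ball p \<rho> \<Longrightarrow> \<zeta> \<noteq> 0 \<Longrightarrow> \<bar>Im \<zeta>\<bar> \<le> Re \<zeta> \<Longrightarrow>
       r x < r (x + \<zeta> *s n)"
proof -
  let ?d = "\<lambda>v z. frechet_derivative r (at z) v"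
  have tends: "(?d v \<longlongrightarrow> ?d v p) (nhds p)" for v
    using cont_U[of v] open_U p_U by (metis continuous_on_eq_continuous_at isCont_def tendsto_at_iff_tendsto_nhds)
  have "dc (\<i> *s n) = \<i>" by (simp add: dc_vsmult n)
  then have "?d n p = 1" "?d (\<i> *s n) p = 0" using n by (simp_all add: dr_eq)
  then have "\<forall>\<^sub>F z in nhds p. dist (?d n z) 1 < 1/4 \<and> dist (?d (\<i> *s n) z) 0 < 1/4 \<and> z \<in> U"
    using tendstoD[OF tends[of n], of "1/4"] tendstoD[OF tends[of "\<i> *s n"], of "1/4"] 
      eventually_nhds_in_open[OF open_U p_U] by (auto intro: eventually_conj)
  then obtain \<rho> where \<rho>: "\<rho> > 0" and
    H: "\<And>z. dist z p < \<rho> \<Longrightarrow> dist (?d n z) 1 < 1/4 \<and> dist (?d (\<i> *s n) z) 0 < 1/4 \<and> z \<in> U"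
    unfolding eventually_nhds_metric by blast
  have "r x < r (x + \<zeta> *s n)"
    if x: "x \<in> ball p \<rho>" "x + \<zeta> *s n \<in> ball p \<rho>" and \<zeta>: "\<zeta> \<noteq> 0" "\<bar>Im \<zeta>\<bar> \<le> Re \<zeta>" for x \<zeta>
  proof -
    have seg: "x + t *\<^sub>R (\<zeta> *s n) \<in> ball p \<rho>" if "0 \<le> t" "t \<le> 1" for t
    proof -
      have "(1 - t) *\<^sub>R x + t *\<^sub>R (x + \<zeta> *s n) \<in> ball p \<rho>"
        using convex_ball[of p \<rho>] x that by (simp add: convex_alt)
      moreover have "(1 - t) *\<^sub>R x + t *\<^sub>R (x + \<zeta> *s n) = x + t *\<^sub>R (\<zeta> *s n)"
        by (simp add: algebra_simps)
      ultimately show ?thesis by simp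
    qed
    obtain t where t: "0 < t" "t < 1"
      "r (x + \<zeta> *s n) - r x = frechet_derivative r (at (x + t *\<^sub>R (\<zeta> *s n))) (\<zeta> *s n)"
      by (rule segment_mvt[of r x "\<zeta> *s n"]) (use seg H diff_U in \<open>auto simp: dist_commute\<close>)
    define y where "y = x + t *\<^sub>R (\<zeta> *s n)"
    have "dist y p < \<rho>" using seg[of t] t by (simp add: y_def dist_commute)
    then have y: "\<bar>?d n y - 1\<bar> < 1/4" "\<bar>?d (\<i> *s n) y\<bar> < 1/4" "y \<in> U"
      using H[of y] by (auto simp: dist_real_def)
    have "Re \<zeta> > 0" using \<zeta> by (cases "Re \<zeta> = 0") (auto simp: complex_eq_iff)
    have "r (x + \<zeta> *s n) - r x = Re \<zeta> * ?d n y + Im \<zeta> * ?d (\<i> *s n) y"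
      using t(3) dr_vsmult[OF y(3), of \<zeta> n] by (simp add: y_def)
    moreover have "Re \<zeta> * ?d n y \<ge> Re \<zeta> * (3/4)"
      using y(1)[unfolded abs_less_iff] \<open>Re \<zeta> > 0\<close> by (intro mult_left_mono) linarith+
    moreover have "\<bar>Im \<zeta> * ?d (\<i> *s n) y\<bar> \<le> Re \<zeta> * (1/4)"
      unfolding abs_mult using y(2) \<zeta>(2) \<open>Re \<zeta> > 0\<close> by (intro mult_mono) simp_all
    ultimately show ?thesis using \<open>Re \<zeta> > 0\<close> by linarith
  qed
  moreover have "ball p \<rho> \<subseteq> U" using H by (auto simp: dist_commute)
  ultimately show thesis using that \<rho> by blast
qed

text \<open>This is all that the plane arguments need to know about \<open>v\<close>. Being free of
  second derivatives, the notion also applies to the tangent directions off \<open>l\<close>, once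
  these are known to lead into \<open>D\<close>.\<close>

definition disc_direction :: "complex ^ 'n \<Rightarrow> bool" where
  "disc_direction v \<longleftrightarrow> v \<noteq> 0 \<and> dc v = 0 \<and> (\<exists>\<delta>>0. \<forall>\<zeta>. \<zeta> \<noteq> 0 \<longrightarrow> norm \<zeta> \<le> \<delta> \<longrightarrow> p + \<zeta> *s v \<in> D)"

lemma disc_direction_obtain:
  assumes "disc_direction v" "\<rho> > 0"
  obtains \<delta> where "\<delta> > 0" "\<delta> * norm v < \<rho>"
    "\<And>\<zeta>. \<zeta> \<noteq> 0 \<Longrightarrow> norm \<zeta> \<le> \<delta> \<Longrightarrow> p + \<zeta> *s v \<in> D"
proof -
  obtain \<delta> where \<delta>: "\<delta> > 0" "\<And>\<zeta>. \<zeta> \<noteq> 0 \<Longrightarrow> norm \<zeta> \<le> \<delta> \<Longrightarrow> p + \<zeta> *s v \<in> D" and "v \<noteq> 0"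
    using assms(1) by (auto simp: disc_direction_def)
  define \<delta>' where "\<delta>' = min \<delta> (\<rho> / (2 * norm v))"
  have "\<delta>' * norm v \<le> \<rho> / (2 * norm v) * norm v"
    by (intro mult_right_mono) (auto simp: \<delta>'_def)
  also have "\<dots> < \<rho>" using \<open>v \<noteq> 0\<close> \<open>\<rho> > 0\<close> by simp
  finally show thesis using that[of \<delta>'] \<delta> \<open>v \<noteq> 0\<close> \<open>\<rho> > 0\<close> by (auto simp: \<delta>'_def)
qed

lemma independent_tangent_normal:
  assumes "v \<noteq> 0" "dc v = 0" "dc n \<noteq> 0" "s *s v + t *s n = 0"
  shows "s = 0 \<and> t = 0"
proof -
  have "t * dc n = 0" using arg_cong[OF assms(4), of dc] assms(2) by (simp add: dc_add dc_vsmult dc_0)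
  then have "t = 0" using assms(3) by simp
  then show ?thesis using assms(1,4) by simp
qed

lemma not_pseudoconvex_in_plane_disc_direction:
  assumes v: "disc_direction v" and n: "dc n = 1"
  defines "P \<equiv> {p + s *s v + t *s n | s t. True}"
  shows "\<not> pseudoconvex_in_plane P (P \<inter> D)"
proof
  assume psc: "pseudoconvex_in_plane P (P \<inter> D)"
  obtain \<rho> where \<rho>: "\<rho> > 0" "ball p \<rho> \<subseteq> U"
    and cone: "\<And>x \<zeta>. x \<in> ball p \<rho> \<Longrightarrow> x + \<zeta> *s n \<in> ball p \<rho> \<Longrightarrow> \<zeta> \<noteq> 0 \<Longrightarrow> \<bar>Im \<zeta>\<bar> \<le> Re \<zeta> \<Longrightarrow>
       r x < r (x + \<zeta> *s n)"
    using increasing_in_normal_cone[OF n] by metis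
  obtain \<delta> where \<delta>: "\<delta> > 0" "\<delta> * norm v < \<rho> / 2"
    "\<And>\<zeta>. \<zeta> \<noteq> 0 \<Longrightarrow> norm \<zeta> \<le> \<delta> \<Longrightarrow> p + \<zeta> *s v \<in> D"
    using disc_direction_obtain[OF v, of "\<rho> / 2"] \<rho>(1) by auto
  have "n \<noteq> 0" using n dc_0 by auto
  \<comment> \<open>The radius is shared equally between the displacements along \<open>v\<close>
    and along \<open>n\<close>, so that every point met lies in the ball of the cone
    estimate.\<close>
  define t0 where "t0 = \<rho> / (4 * norm n)"
  have t0: "t0 > 0" "t0 * norm n < \<rho> / 2" using \<rho> \<open>n \<noteq> 0\<close> by (auto simp: t0_def)
  have inD: "(p - of_real t *s n) + \<zeta> *s (of_real \<delta> *s v) \<in> D" if t: "0 < t" "t \<le> t0" and \<zeta>: "norm \<zeta> \<le> 1" for t \<zeta>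
  proof -
    define z where "z = p + (\<zeta> * \<delta>) *s v"
    have nz: "norm ((\<zeta> * \<delta>) *s v) < \<rho> / 2"
    proof -
      have "norm \<zeta> * (\<delta> * norm v) \<le> 1 * (\<delta> * norm v)" using \<zeta> \<delta> by (intro mult_right_mono) auto
      then have "norm \<zeta> * (\<delta> * norm v) < \<rho> / 2" using \<delta>(2) by linarith
      then show ?thesis using \<delta>(1) by (simp add: norm_vsmult norm_mult mult.assoc)
    qed
    have nt: "norm (of_real t *s n) < \<rho> / 2"
    proof -
      have "t * norm n \<le> t0 * norm n" using t by (intro mult_right_mono) auto
      then show ?thesis using t0 t by (simp add: norm_vsmult)
    qed
    have "norm ((\<zeta> * \<delta>) *s v - of_real t *s n) < \<rho>"
      using norm_triangle_ineq4[of "(\<zeta> * \<delta>) *s v" "of_real t *s n"] nz nt by linarith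
    then have b: "z - of_real t *s n \<in> ball p \<rho>" "z \<in> ball p \<rho>"
      using nz \<rho>(1) by (auto simp: z_def dist_norm norm_minus_commute algebra_simps)
    have "r (z - of_real t *s n) < r z"
      using cone[of "z - of_real t *s n" "of_real t"] b t by simp
    also have "r z \<le> 0"
    proof (cases "\<zeta> = 0")
      case True then show ?thesis by (simp add: z_def r_p)
    next
      case False
      have "norm (\<zeta> * \<delta>) \<le> \<delta>" using \<zeta> \<delta>(1) by (simp add: norm_mult mult_left_le_one_le)
      then have "z \<in> D" using \<delta> False by (simp add: z_def)
      then show ?thesis using mem_D_iff[of z] b \<rho> by auto
    qed
    finally have "z - of_real t *s n \<in> D" using mem_D_iff b \<rho> by auto
    then show ?thesis by (simp add: z_def vector_smult_assoc algebra_simps)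
  qed
  \<comment> \<open>This point is \<open>p\<close>, written as the centre of the limit disc.\<close>
  have "(p - of_real 0 *s n) + 0 *s (of_real \<delta> *s v) \<in> D"
  proof (rule pseudoconvex_in_plane_disc_continuity[OF psc, of "{0..t0}" "\<lambda>t. p - of_real t *s n" _ t0])
    show "continuous_on {0..t0} (\<lambda>t. p - complex_of_real t *s n)"
      by (intro continuous_intros)
    show "p - of_real \<tau> *s n + \<zeta> *s (of_real \<delta> *s v) \<in> P" for \<tau> \<zeta>
    proof -
      have "p - of_real \<tau> *s n + \<zeta> *s (of_real \<delta> *s v) = p + (\<zeta> * \<delta>) *s v + (- of_real \<tau>) *s n"
        by (simp add: vector_smult_assoc vector_smult_lneg)
      then show ?thesis unfolding P_def by blast
    qed
    show "p - of_real \<tau> *s n + \<zeta> *s (of_real \<delta> *s v) \<in> D" if "\<tau> \<in> {0..t0}" "norm \<zeta> = 1" for \<tau> \<zeta>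
    proof (cases "\<tau> = 0")
      case True
      have "\<zeta> * of_real \<delta> \<noteq> 0" "norm (\<zeta> * of_real \<delta>) \<le> \<delta>" using that \<delta>(1) by (auto simp: norm_mult)
      then show ?thesis using \<delta>(3)[of "\<zeta> * \<delta>"] True by (simp add: vector_smult_assoc)
    next
      case False then show ?thesis using inD[of \<tau> \<zeta>] that by auto
    qed
  qed (use t0 inD in auto)
  then show False using p_notin_D by simp
qed

text \<open>The freedom lies in the normal spanning the plane together with \<open>v\<close>: for
  \<open>b\<close> off the tangent hyperplane it is chosen proportional to \<open>b - p\<close>, and
  for \<open>b\<close> on the line of \<open>v\<close> any normal will do.\<close>

lemma nonpseudoconvex_plane_through:
  assumes v: "disc_direction v" and b: "dc (b - p) \<noteq> 0 \<or> (\<exists>\<zeta>. b = p + \<zeta> *s v)"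
  shows "\<exists>P. complex_plane P \<and> p \<in> P \<and> b \<in> P \<and> \<not> pseudoconvex_in_plane P (P \<inter> D)"
proof -
  obtain n s t where n: "dc n = 1" and b_eq: "b = p + s *s v + t *s n"
  proof (cases "dc (b - p) = 0")
    case True
    then obtain \<zeta> where "b = p + \<zeta> *s v" using b by blast
    moreover obtain n where "dc n = 1" using normal_exists by blast
    ultimately show ?thesis using that[of n \<zeta> 0] by simp
  next
    case False
    define x where "x = b - p"
    have "b = p + x" "dc x \<noteq> 0" using False by (simp_all add: x_def)
    then show ?thesis
      using that[of "(1 / dc x) *s x" 0 "dc x"] by (simp add: dc_vsmult vector_smult_assoc)
  qed
  let ?P = "{p + s *s v + t *s n | s t. True}"
  have "complex_plane ?P"
    by (rule complex_plane_span, rule independent_tangent_normal[of v n]) (use v n in \<open>simp_all add: disc_direction_def\<close>)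
  moreover have "p \<in> ?P"
    by (rule CollectI, rule exI[of _ 0], rule exI[of _ 0]) simp
  moreover have "b \<in> ?P" using b_eq by blast
  ultimately show ?thesis using not_pseudoconvex_in_plane_disc_direction[OF v n] by blast
qed

end

lemma compact_subset_open_margin:
  fixes K :: "'a::real_normed_vector set"
  assumes "compact K" "open D" "K \<subseteq> D"
  obtains e where "e > 0" "\<And>x h. x \<in> K \<Longrightarrow> norm h < e \<Longrightarrow> x + h \<in> D"
proof -
  obtain e where e: "e > 0" "\<And>x. x \<in> K \<Longrightarrow> ball x e \<subseteq> D"
    using compact_subset_open_imp_ball_epsilon_subset[OF assms] by (metis UN_subset_iff)
  have "x + h \<in> D" if "x \<in> K" "norm h < e" for x h
    using e(2)[OF that(1)] that(2) by (auto simp: dist_norm)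
  with e(1) that show thesis by blast
qed

context boundary_point
begin

text \<open>The planes used are \<open>a + span (v + \<alpha> n, w + \<beta> n)\<close> with \<open>\<alpha> z\<^sub>1 = t |z\<^sub>1|\<close> and
  \<open>\<beta> = t |z\<^sub>1| / 4\<close>: over \<open>0\<close> the disc in direction \<open>v + \<alpha> n\<close> is pushed into \<open>D\<close> by \<open>- \<beta> n\<close>,
  while over \<open>z\<^sub>2\<close> its point with parameter \<open>z\<^sub>1\<close> lies above \<open>p + z\<^sub>1 v + z\<^sub>2 w\<close> in the
  sense of the normal cone.\<close>

lemma tangent_slice_outside_line:
  assumes a: "p + w \<notin> S D" and v: "disc_direction v" and n: "dc n = 1" and w: "dc w = 0"
    and indep: "\<And>s t. s *s v + t *s w = 0 \<Longrightarrow> s = 0 \<and> t = 0"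
    and \<rho>: "\<rho> > 0" "ball p \<rho> \<subseteq> U"
    and cone: "\<And>x \<zeta>. x \<in> ball p \<rho> \<Longrightarrow> x + \<zeta> *s n \<in> ball p \<rho> \<Longrightarrow> \<zeta> \<noteq> 0 \<Longrightarrow> \<bar>Im \<zeta>\<bar> \<le> Re \<zeta> \<Longrightarrow>
       r x < r (x + \<zeta> *s n)"
    and \<delta>: "\<delta> > 0" "\<delta> * norm v < \<rho> / 4" "\<And>\<zeta>. \<zeta> \<noteq> 0 \<Longrightarrow> norm \<zeta> \<le> \<delta> \<Longrightarrow> p + \<zeta> *s v \<in> D"
    and e: "e > 0" "\<And>\<zeta> h. norm \<zeta> = \<delta> \<Longrightarrow> norm h < e \<Longrightarrow> p + \<zeta> *s v + h \<in> D"
    and \<epsilon>: "\<epsilon> > 0" "\<epsilon> \<le> 1" "\<epsilon> * norm w < e / 2" "\<epsilon> * norm w < \<rho> / 4"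
    and z: "z1 \<noteq> 0" "norm z1 \<le> \<delta>" "norm z2 < \<epsilon>"
  shows "p + z1 *s v + z2 *s w \<in> D"
proof -
  \<comment> \<open>The lowering will be \<open>t * \<eta>\<close>. The quarter makes the lift
    \<open>t * norm z1\<close> at \<open>z1\<close> four times as large, while for
    \<open>norm \<xi> < \<eta> / 2\<close> the lift is at most half of the lowering.\<close>
  define \<eta> where "\<eta> = norm z1 / 4"
  have \<eta>: "\<eta> > 0" "\<eta> \<le> \<delta>" using z \<delta>(1) by (auto simp: \<eta>_def)
  have vb: "norm (\<zeta> *s v) < \<rho> / 4" if "norm \<zeta> \<le> \<delta>" for \<zeta>
  proof -
    have "norm \<zeta> * norm v \<le> \<delta> * norm v" using that by (intro mult_right_mono) auto
    then show ?thesis using \<delta>(2) by (simp add: norm_vsmult)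
  qed
  have wb: "norm (\<tau> *s w) < e / 2" "norm (\<tau> *s w) < \<rho> / 4" if "norm \<tau> < \<epsilon>" for \<tau>
  proof -
    have "norm \<tau> * norm w \<le> \<epsilon> * norm w" using that by (intro mult_right_mono) auto
    then show "norm (\<tau> *s w) < e / 2" "norm (\<tau> *s w) < \<rho> / 4" using \<epsilon> by (auto simp: norm_vsmult)
  qed
  \<comment> \<open>On this annulus the punctured disc keeps a positive distance \<open>e2\<close>
    from the complement of \<open>D\<close>. The margin is found before the slope \<open>t\<close>
    is chosen.\<close>
  have "compact ((\<lambda>\<zeta>. p + \<zeta> *s v) ` (cball 0 \<delta> - ball 0 (\<eta> / 2)))"
    by (intro compact_continuous_image continuous_intros compact_diff compact_cball open_ball)
  moreover have "(\<lambda>\<zeta>. p + \<zeta> *s v) ` (cball 0 \<delta> - ball 0 (\<eta> / 2)) \<subseteq> D"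
  proof clarify
    fix \<zeta> :: complex assume "\<zeta> \<in> cball 0 \<delta>" "\<zeta> \<notin> ball 0 (\<eta> / 2)"
    then show "p + \<zeta> *s v \<in> D" using \<delta>(3)[of \<zeta>] \<eta>(1) by (cases "\<zeta> = 0") auto
  qed
  ultimately obtain e2 where "e2 > 0" and margin:
    "\<And>x h. x \<in> (\<lambda>\<zeta>. p + \<zeta> *s v) ` (cball 0 \<delta> - ball 0 (\<eta> / 2)) \<Longrightarrow> norm h < e2 \<Longrightarrow> x + h \<in> D"
    by (rule compact_subset_open_margin[OF _ open_D]) (rule that)
  have e2: "e2 > 0"
    "\<And>\<zeta> h. norm \<zeta> \<le> \<delta> \<Longrightarrow> \<eta> / 2 \<le> norm \<zeta> \<Longrightarrow> norm h < e2 \<Longrightarrow> p + \<zeta> *s v + h \<in> D"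
    using \<open>e2 > 0\<close> by (auto intro!: margin)
  define m where "m = min (e / 2) (min e2 (\<rho> / 4))"
  have m: "m > 0" "m \<le> e / 2" "m \<le> e2" "m \<le> \<rho> / 4"
    using e e2 \<rho> by (auto simp: m_def)
  \<comment> \<open>For \<open>norm \<tau> \<le> 1\<close> and
    \<open>norm \<xi> \<le> \<delta>\<close> the coefficient of \<open>n\<close> is at most
    \<open>2 * t * \<eta>\<close> from \<open>\<beta> * (\<tau> - 1)\<close> plus
    \<open>t * \<delta>\<close> from \<open>\<alpha> * \<xi>\<close>. This \<open>t\<close> keeps
    the resulting displacement below every margin.\<close>
  define t where "t = m / (2 * ((2 * \<eta> + \<delta>) * (norm n + 1)))"
  have A: "(2 * \<eta> + \<delta>) * (norm n + 1) > 0" using \<eta> \<delta> by (intro mult_pos_pos) (auto intro: add_nonneg_pos)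
  have t: "t > 0" using A m by (simp add: t_def)
  have tm: "t * ((2 * \<eta> + \<delta>) * (norm n + 1)) < m"
  proof -
    have "m / (2 * X) * X < m" if "X > 0" for X using that m(1) by simp
    then show ?thesis using A unfolding t_def by blast
  qed
  have nb: "norm (\<xi> *s n) < m" if "norm \<xi> \<le> t * (2 * \<eta> + \<delta>)" for \<xi>
  proof -
    have "norm \<xi> * norm n \<le> (t * (2 * \<eta> + \<delta>)) * (norm n + 1)"
      using that t \<eta> \<delta> by (intro mult_mono) auto
    then show ?thesis using tm by (simp add: norm_vsmult mult.assoc)
  qed
  \<comment> \<open>The conjugate phase makes the lift at the prescribed parameter \<open>z1\<close>
    real and positive.\<close>
  define \<alpha> where "\<alpha> = of_real t * cnj (sgn z1)"
  define \<beta> where "\<beta> = complex_of_real (t * \<eta>)"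
  have \<alpha>: "norm \<alpha> = t" using z(1) t by (simp add: \<alpha>_def norm_mult norm_sgn)
  have \<alpha>z: "\<alpha> * z1 = of_real (t * norm z1)"
  proof -
    have "cnj (sgn z1) * z1 = of_real (norm z1)"
      using z(1) complex_norm_square[of z1] by (simp add: sgn_eq field_simps power2_eq_square)
    then show ?thesis by (simp add: \<alpha>_def mult.assoc)
  qed
  define P where "P = {(p + w) + s *s (v + \<alpha> *s n) + s' *s (w + \<beta> *s n) | s s'. True}"
  have "complex_plane P" unfolding P_def
  proof (rule complex_plane_span)
    fix s s' assume eq: "s *s (v + \<alpha> *s n) + s' *s (w + \<beta> *s n) = 0"
    then have "s * \<alpha> + s' * \<beta> = 0"
    proof -
      have "dc v = 0" using v by (simp add: disc_direction_def)
      have "s * \<alpha> + s' * \<beta> = dc (s *s (v + \<alpha> *s n) + s' *s (w + \<beta> *s n))"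
        by (simp only: dc_add dc_vsmult \<open>dc v = 0\<close> w n) simp
      then show ?thesis unfolding eq dc_0 .
    qed
    moreover have "s *s v + s' *s w + (s * \<alpha> + s' * \<beta>) *s n = 0"
      using eq by (simp add: vector_add_ldistrib vector_sadd_rdistrib vector_smult_assoc algebra_simps)
    ultimately show "s = 0 \<and> s' = 0" using indep by simp
  qed
  moreover have "p + w \<in> P"
    unfolding P_def by (rule CollectI, rule exI[of _ 0], rule exI[of _ 0]) simp
  ultimately have psc: "pseudoconvex_in_plane P (P \<inter> D)"
    using a by (auto simp: S_def)
  \<comment> \<open>The factor \<open>\<tau> - 1\<close> vanishes at the parameter of
    \<open>p + w\<close>, where the plane is held fixed; over \<open>\<tau> = 0\<close> the centre
    is lowered by \<open>\<beta> *s n\<close>.\<close>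
  define c where "c = (\<lambda>\<tau>. p + \<tau> *s w + (\<beta> * (\<tau> - 1)) *s n)"
  define v' where "v' = of_real \<delta> *s (v + \<alpha> *s n)"
  have pt: "c \<tau> + \<zeta> *s v' = p + (\<zeta> * \<delta>) *s v + (\<tau> *s w + (\<beta> * (\<tau> - 1) + \<alpha> * (\<zeta> * \<delta>)) *s n)" for \<tau> \<zeta>
    by (simp add: c_def v'_def vector_add_ldistrib vector_sadd_rdistrib vector_smult_assoc algebra_simps)
  have \<delta>': "norm (\<zeta> * \<delta>) \<le> \<delta>" if "norm \<zeta> \<le> 1" for \<zeta> :: complex
    using that \<delta>(1) by (simp add: norm_mult mult_left_le_one_le)
  have small: "norm (\<beta> * (\<tau> - 1) + \<alpha> * \<xi>) \<le> t * (2 * \<eta> + \<delta>)" if "norm \<tau> \<le> 1" "norm \<xi> \<le> \<delta>" for \<tau> \<xi>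
  proof -
    have "norm (\<tau> - 1) \<le> 2" using norm_triangle_ineq4[of \<tau> 1] that(1) by simp
    then have "norm (\<beta> * (\<tau> - 1)) \<le> t * \<eta> * 2"
      using t \<eta> by (simp add: \<beta>_def norm_mult mult_left_mono)
    moreover have "norm (\<alpha> * \<xi>) \<le> t * \<delta>"
      using t that(2) by (simp add: norm_mult \<alpha> mult_left_mono)
    ultimately show ?thesis
      using norm_triangle_ineq[of "\<beta> * (\<tau> - 1)" "\<alpha> * \<xi>"] by (simp add: algebra_simps)
  qed
  have "c z2 + (z1 / \<delta>) *s v' \<in> D"
  proof (rule pseudoconvex_in_plane_disc_continuity[OF psc, of "ball 0 \<epsilon>" c v' 0])
    show "continuous_on (ball 0 \<epsilon>) c" unfolding c_def by (intro continuous_intros)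
    show "c \<tau> + \<zeta> *s v' \<in> P" for \<tau> \<zeta>
    proof -
      have "c \<tau> + \<zeta> *s v' = p + w + (\<zeta> * \<delta>) *s (v + \<alpha> *s n) + (\<tau> - 1) *s (w + \<beta> *s n)"
        unfolding pt by (simp add: vector_add_ldistrib vector_sadd_rdistrib vector_ssub_ldistrib vector_smult_assoc algebra_simps vec.scale_left_diff_distrib)
      then show ?thesis unfolding P_def by blast
    qed
    show "c \<tau> + \<zeta> *s v' \<in> D" if "\<tau> \<in> ball 0 \<epsilon>" "norm \<zeta> = 1" for \<tau> \<zeta>
      unfolding pt
    proof (rule e(2))
      show "norm (\<zeta> * of_real \<delta>) = \<delta>" using that \<delta>(1) by (simp add: norm_mult)
      have "norm ((\<beta> * (\<tau> - 1) + \<alpha> * (\<zeta> * \<delta>)) *s n) < e / 2"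
        using nb[OF small[of \<tau> "\<zeta> * \<delta>"]] that \<epsilon>(2) \<delta>'[of \<zeta>] m(2) by auto
      then show "norm (\<tau> *s w + (\<beta> * (\<tau> - 1) + \<alpha> * (\<zeta> * \<delta>)) *s n) < e"
        using norm_triangle_ineq[of "\<tau> *s w"] wb(1)[of \<tau>] that(1)
        by (smt (verit) field_sum_of_halves mem_ball_0)
    qed
    show "c 0 + \<zeta> *s v' \<in> D" if "norm \<zeta> \<le> 1" for \<zeta>
    proof -
      define \<xi> where "\<xi> = \<zeta> * \<delta>"
      have \<xi>: "norm \<xi> \<le> \<delta>" using \<delta>'[OF that] by (simp add: \<xi>_def)
      have bd: "norm ((\<alpha> * \<xi> - \<beta>) *s n) < m"
        using nb[OF small[of 0 \<xi>]] \<xi> by (simp add: algebra_simps)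
      have eq: "c 0 + \<zeta> *s v' = p + \<xi> *s v + (\<alpha> * \<xi> - \<beta>) *s n"
        unfolding pt by (simp add: \<xi>_def algebra_simps)
      show ?thesis
      \<comment> \<open>Away from the centre the margin \<open>e2\<close> absorbs the normal
        displacement. Near the centre the lift is at most half of \<open>\<beta>\<close>, so the
        disc point lies below \<open>p + \<xi> *s v\<close> in the sense of the cone.\<close>
      proof (cases "\<eta> / 2 \<le> norm \<xi>")
        case True then show ?thesis unfolding eq using e2(2)[of \<xi>] \<xi> bd m(3) by auto
      next
        case False
        define x where "x = p + \<xi> *s v + (\<alpha> * \<xi> - \<beta>) *s n"
        have le: "\<bar>Re (\<alpha> * \<xi>)\<bar> \<le> t * \<eta> / 2" "\<bar>Im (\<alpha> * \<xi>)\<bar> \<le> t * \<eta> / 2"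
        proof -
          have "norm (\<alpha> * \<xi>) \<le> t * (\<eta> / 2)" using False t unfolding norm_mult \<alpha> by (intro mult_left_mono) auto
          then show "\<bar>Re (\<alpha> * \<xi>)\<bar> \<le> t * \<eta> / 2" "\<bar>Im (\<alpha> * \<xi>)\<bar> \<le> t * \<eta> / 2"
            using abs_Re_le_cmod[of "\<alpha> * \<xi>"] abs_Im_le_cmod[of "\<alpha> * \<xi>"] by auto
        qed
        have pos: "t * \<eta> > 0" using t \<eta> by simp
        have Re: "Re (\<beta> - \<alpha> * \<xi>) = t * \<eta> - Re (\<alpha> * \<xi>)" and Im: "Im (\<beta> - \<alpha> * \<xi>) = - Im (\<alpha> * \<xi>)"
          by (simp_all add: \<beta>_def)
        have x: "x + (\<beta> - \<alpha> * \<xi>) *s n = p + \<xi> *s v"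
          by (simp add: x_def vec.scale_left_diff_distrib)
        have inb: "p + \<xi> *s v \<in> ball p \<rho>" "x \<in> ball p \<rho>"
        proof -
          show "p + \<xi> *s v \<in> ball p \<rho>" using vb[OF \<xi>] \<rho>(1) by (simp add: dist_norm)
          have "norm (\<xi> *s v + (\<alpha> * \<xi> - \<beta>) *s n) < \<rho>"
            using norm_triangle_ineq[of "\<xi> *s v" "(\<alpha> * \<xi> - \<beta>) *s n"] vb[OF \<xi>] bd m(4) \<rho>(1) by linarith
          moreover have "dist p x = norm (\<xi> *s v + (\<alpha> * \<xi> - \<beta>) *s n)"
            unfolding dist_commute[of p] by (simp add: dist_norm x_def add.assoc)
          ultimately show "x \<in> ball p \<rho>" by simp
        qed
        have "r x < r (x + (\<beta> - \<alpha> * \<xi>) *s n)"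
        proof (rule cone)
          show "\<bar>Im (\<beta> - \<alpha> * \<xi>)\<bar> \<le> Re (\<beta> - \<alpha> * \<xi>)" unfolding Re Im using le by linarith
          have "Re (\<beta> - \<alpha> * \<xi>) > 0" unfolding Re using le pos by linarith
          then show "\<beta> - \<alpha> * \<xi> \<noteq> 0" by auto
        qed (use inb x in auto)
        also have "\<dots> \<le> 0"
        proof (cases "\<xi> = 0")
          case True then show ?thesis unfolding x by (simp add: r_p)
        next
          case False
          then have "p + \<xi> *s v \<in> D" using \<delta>(3) \<xi> by blast
          then show ?thesis unfolding x using mem_D_iff inb \<rho>(2) by (meson less_imp_le subsetD)
        qed
        finally have "x \<in> D" using mem_D_iff inb \<rho>(2) by blast
        then show ?thesis unfolding eq x_def .
      qed
    qed
    show "norm (z1 / \<delta>) \<le> 1" using z \<delta>(1) by (simp add: norm_divide)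
  qed (use \<epsilon> z in auto)
  moreover have "z1 / \<delta> * \<delta> = z1" using \<delta>(1) by simp
  ultimately have X: "p + z1 *s v + (z2 *s w + (\<beta> * (z2 - 1) + \<alpha> * z1) *s n) \<in> D"
    unfolding pt by simp
  define x where "x = p + z1 *s v + z2 *s w"
  define \<zeta> where "\<zeta> = \<beta> * (z2 - 1) + \<alpha> * z1"
  have XD: "x + \<zeta> *s n \<in> D" using X by (simp add: x_def \<zeta>_def algebra_simps)
  have "norm ((\<beta> * (z2 - 1) + \<alpha> * z1) *s n) < \<rho> / 4"
    using nb[OF small[of z2 z1]] z \<epsilon>(2) m(4) by auto
  then have nz: "norm (\<zeta> *s n) < \<rho> / 4" by (simp add: \<zeta>_def)
  have nx: "norm (z1 *s v + z2 *s w) < \<rho> / 2"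
    using norm_triangle_ineq[of "z1 *s v" "z2 *s w"] vb[OF z(2)] wb(2)[OF z(3)] by linarith
  have inb: "x \<in> ball p \<rho>" "x + \<zeta> *s n \<in> ball p \<rho>"
  proof -
    have "dist p x = norm (z1 *s v + z2 *s w)"
      unfolding dist_commute[of p] by (simp add: dist_norm x_def add.assoc)
    then show "x \<in> ball p \<rho>" using nx \<rho>(1) by simp
    have "dist p (x + \<zeta> *s n) = norm (z1 *s v + z2 *s w + \<zeta> *s n)"
      unfolding dist_commute[of p] by (simp add: dist_norm x_def add.assoc)
    also have "\<dots> < \<rho>" using norm_triangle_ineq[of "z1 *s v + z2 *s w" "\<zeta> *s n"] nx nz \<rho>(1) by linarith
    finally show "x + \<zeta> *s n \<in> ball p \<rho>" by simp
  qed
  have "r x < r (x + \<zeta> *s n)"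
  proof (rule cone[OF inb])
    \<comment> \<open>Since \<open>\<alpha> * z1\<close> equals \<open>4 * t * \<eta>\<close>, the
      height is a positive multiple of \<open>z2 - 1 + 4\<close>, which lies in the cone because
      \<open>norm z2 < 1\<close>.\<close>
    have eq: "\<zeta> = of_real (t * \<eta>) * (z2 + 3)"
      by (simp add: \<zeta>_def \<alpha>z \<beta>_def \<eta>_def field_simps)
    have pos: "t * \<eta> > 0" using t \<eta> by simp
    have "\<bar>Re z2\<bar> \<le> 1" "\<bar>Im z2\<bar> \<le> 1" using abs_Re_le_cmod[of z2] abs_Im_le_cmod[of z2] z(3) \<epsilon>(2) by auto
    then have "\<bar>Im z2\<bar> \<le> Re z2 + 3" "Re z2 + 3 > 0" by auto
    then have "t * \<eta> * \<bar>Im z2\<bar> \<le> t * \<eta> * (Re z2 + 3)" using pos by (intro mult_left_mono) auto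
    then show "\<bar>Im \<zeta>\<bar> \<le> Re \<zeta>" using pos t \<eta> by (simp add: eq abs_mult)
    have "Re \<zeta> > 0" unfolding eq using pos \<open>Re z2 + 3 > 0\<close> by simp
    then show "\<zeta> \<noteq> 0" by auto
  qed
  also have "\<dots> < 0" using XD mem_D_iff inb \<rho>(2) by blast
  finally show ?thesis using mem_D_iff inb \<rho>(2) unfolding x_def by blast
qed

text \<open>The points off the line come first, because they supply the boundary circles for the
  untilted plane. There, if \<open>p + z2 *s w\<close> were in \<open>D\<close>, the whole disc over
  \<open>z2\<close> would be, and moving it back to the parameter \<open>0\<close> would put
  \<open>p\<close> into \<open>D\<close>.\<close>

lemma tangent_slice:
  assumes a: "p + w \<notin> S D" and v: "disc_direction v" and w: "dc w = 0"
    and indep: "\<And>s t. s *s v + t *s w = 0 \<Longrightarrow> s = 0 \<and> t = 0"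
  obtains \<delta> where "\<delta> > 0"
    "\<And>z1 z2. norm z1 < \<delta> \<Longrightarrow> norm z2 < \<delta> \<Longrightarrow> p + z1 *s v + z2 *s w \<in> D \<longleftrightarrow> z1 \<noteq> 0"
proof -
  obtain n where n: "dc n = 1" using normal_exists by blast
  obtain \<rho> where \<rho>: "\<rho> > 0" "ball p \<rho> \<subseteq> U"
    and cone: "\<And>x \<zeta>. x \<in> ball p \<rho> \<Longrightarrow> x + \<zeta> *s n \<in> ball p \<rho> \<Longrightarrow> \<zeta> \<noteq> 0 \<Longrightarrow> \<bar>Im \<zeta>\<bar> \<le> Re \<zeta> \<Longrightarrow>
       r x < r (x + \<zeta> *s n)"
    using increasing_in_normal_cone[OF n] by metis
  obtain \<delta> where \<delta>: "\<delta> > 0" "\<delta> * norm v < \<rho> / 4"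
    "\<And>\<zeta>. \<zeta> \<noteq> 0 \<Longrightarrow> norm \<zeta> \<le> \<delta> \<Longrightarrow> p + \<zeta> *s v \<in> D"
    using disc_direction_obtain[OF v, of "\<rho> / 4"] \<rho>(1) by auto
  have "compact ((\<lambda>\<zeta>. p + \<zeta> *s v) ` sphere 0 \<delta>)"
    by (intro compact_continuous_image continuous_intros compact_sphere)
  moreover have "(\<lambda>\<zeta>. p + \<zeta> *s v) ` sphere 0 \<delta> \<subseteq> D" using \<delta> by auto
  ultimately obtain e where e0: "e > 0" and margin:
    "\<And>x h. x \<in> (\<lambda>\<zeta>. p + \<zeta> *s v) ` sphere 0 \<delta> \<Longrightarrow> norm h < e \<Longrightarrow> x + h \<in> D"
    by (rule compact_subset_open_margin[OF _ open_D]) (rule that)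
  have e: "e > 0" "\<And>\<zeta> h. norm \<zeta> = \<delta> \<Longrightarrow> norm h < e \<Longrightarrow> p + \<zeta> *s v + h \<in> D"
    using e0 by (auto intro!: margin)
  define m where "m = min (e / 2) (\<rho> / 4)"
  \<comment> \<open>The bound 1 gives the cone condition on the heights over \<open>z2\<close>; the
    other bound fits displacements along \<open>w\<close> into half of the margin \<open>e\<close>
    and a quarter of the radius \<open>\<rho>\<close>.\<close>
  define \<epsilon> where "\<epsilon> = min 1 (m / (2 * (norm w + 1)))"
  have m: "m > 0" using e \<rho> by (simp add: m_def)
  have nw: "norm w + 1 > 0" by (rule add_nonneg_pos) auto
  have \<epsilon>: "\<epsilon> > 0" "\<epsilon> \<le> 1" using m nw by (auto simp: \<epsilon>_def)
  have "\<epsilon> * norm w \<le> m / (2 * (norm w + 1)) * (norm w + 1)"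
    using \<epsilon> by (intro mult_mono) (auto simp: \<epsilon>_def)
  also have "\<dots> < m"
  proof -
    have "m / (2 * X) * X < m" if "X > 0" for X using that m by simp
    then show ?thesis using nw by blast
  qed
  finally have \<epsilon>w: "\<epsilon> * norm w < e / 2" "\<epsilon> * norm w < \<rho> / 4" by (auto simp: m_def)
  have out: "p + z1 *s v + z2 *s w \<in> D" if "z1 \<noteq> 0" "norm z1 \<le> \<delta>" "norm z2 < \<epsilon>" for z1 z2
    by (rule tangent_slice_outside_line[OF a v n w indep \<rho> cone \<delta> e \<epsilon> \<epsilon>w that])
  have line: "p + z2 *s w \<notin> D" if z2: "norm z2 < \<epsilon>" for z2
  proof
    assume zD: "p + z2 *s w \<in> D"
    define P where "P = {(p + w) + s *s v + s' *s w | s s'. True}"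
    have "complex_plane P" unfolding P_def by (rule complex_plane_span[OF indep])
    moreover have "p + w \<in> P"
      unfolding P_def by (rule CollectI, rule exI[of _ 0], rule exI[of _ 0]) simp
    ultimately have psc: "pseudoconvex_in_plane P (P \<inter> D)"
      using a by (auto simp: S_def)
    have pt: "p + \<tau> *s w + \<zeta> *s (of_real \<delta> *s v) = p + (\<zeta> * \<delta>) *s v + \<tau> *s w" for \<tau> \<zeta>
      by (simp add: vector_smult_assoc)
    have "p + 0 *s w + 0 *s (of_real \<delta> *s v) \<in> D"
    proof (rule pseudoconvex_in_plane_disc_continuity[OF psc, of "ball 0 \<epsilon>" "\<lambda>\<tau>. p + \<tau> *s w" _ z2])
      show "continuous_on (ball 0 \<epsilon>) (\<lambda>\<tau>. p + \<tau> *s w)" by (intro continuous_intros)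
      show "p + \<tau> *s w + \<zeta> *s (of_real \<delta> *s v) \<in> P" for \<tau> \<zeta>
      proof -
        have "p + \<tau> *s w + \<zeta> *s (of_real \<delta> *s v) = p + w + (\<zeta> * \<delta>) *s v + (\<tau> - 1) *s w"
          by (simp add: pt vec.scale_left_diff_distrib)
        then show ?thesis unfolding P_def by blast
      qed
      show "p + \<tau> *s w + \<zeta> *s (of_real \<delta> *s v) \<in> D" if "\<tau> \<in> ball 0 \<epsilon>" "norm \<zeta> = 1" for \<tau> \<zeta>
        unfolding pt using that \<delta>(1) by (intro out) (auto simp: norm_mult)
      show "p + z2 *s w + \<zeta> *s (of_real \<delta> *s v) \<in> D" if "norm \<zeta> \<le> 1" for \<zeta>
      proof (cases "\<zeta> = 0")
        case False
        then show ?thesis unfolding pt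
          using that \<delta>(1) z2 by (intro out) (auto simp: norm_mult mult_left_le_one_le)
      qed (use zD in simp)
    qed (use \<epsilon> z2 in auto)
    then show False using p_notin_D by simp
  qed
  show thesis
  proof (rule that)
    show "min \<delta> \<epsilon> > 0" using \<delta> \<epsilon> by simp
    show "p + z1 *s v + z2 *s w \<in> D \<longleftrightarrow> z1 \<noteq> 0" if "norm z1 < min \<delta> \<epsilon>" "norm z2 < min \<delta> \<epsilon>" for z1 z2
      using out[of z1 z2] line[of z2] that by (cases "z1 = 0") auto
  qed
qed

end

section \<open>Hessian and Levi form\<close>

locale twice_differentiable_boundary_point = boundary_point D U p r
  for D U :: "(complex ^ 'n) set" and p :: "complex ^ 'n" and r :: "complex ^ 'n \<Rightarrow> real" +
  assumes twice: "twice_differentiable_at r p"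
begin

abbreviation H :: "complex ^ 'n \<Rightarrow> complex ^ 'n \<Rightarrow> real" where "H \<equiv> hessian r p"

lemma hessian_has_derivative:
  "((\<lambda>z. frechet_derivative r (at z) Y) has_derivative (\<lambda>X. H X Y)) (at p)"
  using twice unfolding twice_differentiable_at_def hessian_def frechet_derivative_works by blast

lemma linear_hessian_left: "linear (\<lambda>X. H X Y)"
  using hessian_has_derivative by (rule has_derivative_linear)

lemma hessian_eqI:
  assumes "(f has_derivative f') (at p)" "\<And>z. z \<in> U \<Longrightarrow> frechet_derivative r (at z) Y = f z"
  shows "H X Y = f' X"
proof -
  have "((\<lambda>z. frechet_derivative r (at z) Y) has_derivative f') (at p)"
    by (rule has_derivative_transform_within_open[OF assms(1) open_U p_U]) (simp add: assms(2))
  then show ?thesis using has_derivative_unique[OF hessian_has_derivative] by metis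
qed

text \<open>Here \<open>Y\<close> enters through the first derivative at all points near
  \<open>p\<close>. Its linearity there passes to the Hessian by uniqueness of the
  derivative.\<close>

lemma linear_hessian_right: "linear (H X)"
proof
  show "H X (Y + Y') = H X Y + H X Y'" for Y Y'
    by (rule hessian_eqI[OF has_derivative_add[OF hessian_has_derivative hessian_has_derivative]])
      (simp add: linear_add linear_dr)
  show "H X (c *\<^sub>R Y) = c *\<^sub>R H X Y" for c Y
    by (rule hessian_eqI[OF has_derivative_scaleR_right[OF hessian_has_derivative]])
      (simp add: linear_scale linear_dr)
qed

lemma bilinear_hessian: "bilinear H"
  by (simp add: bilinear_def linear_hessian_left linear_hessian_right)

text \<open>The quantitative form of differentiability of the first derivative at \<open>p\<close>,
  for one fixed direction \<open>Y\<close>. Values of \<open>r\<close> are recovered from it through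
  the mean value theorem on segments.\<close>

lemma dr_expansion:
  assumes "e > 0"
  obtains \<delta> where "\<delta> > 0" "ball p \<delta> \<subseteq> U"
    "\<And>x. norm x < \<delta> \<Longrightarrow>
      \<bar>frechet_derivative r (at (p + x)) Y - frechet_derivative r (at p) Y - H x Y\<bar> \<le> e * norm x"
proof -
  obtain \<delta> where \<delta>: "\<delta> > 0" "\<And>y. norm (y - p) < \<delta> \<Longrightarrow>
      norm (frechet_derivative r (at y) Y - frechet_derivative r (at p) Y - H (y - p) Y) \<le> e * norm (y - p)"
    using hessian_has_derivative[of Y] assms unfolding has_derivative_at_alt by metis
  obtain \<delta>' where \<delta>': "\<delta>' > 0" "ball p \<delta>' \<subseteq> U"
    using open_U p_U open_contains_ball by blast
  show thesis
  proof (rule that)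
    show "min \<delta> \<delta>' > 0" "ball p (min \<delta> \<delta>') \<subseteq> U" using \<delta>(1) \<delta>' by auto
    show "\<bar>frechet_derivative r (at (p + x)) Y - frechet_derivative r (at p) Y - H x Y\<bar> \<le> e * norm x"
      if "norm x < min \<delta> \<delta>'" for x
      using \<delta>(2)[of "p + x"] that by simp
  qed
qed

lemma hessian_vsmult_right: "H X (c *s Y) = Re c * H X Y + Im c * H X (\<i> *s Y)"
  by (subst vsmult_split) (simp add: linear_add linear_scale linear_hessian_right)

lemma hessian_vsmult_left: "H (c *s X) Y = Re c * H X Y + Im c * H (\<i> *s X) Y"
  by (subst vsmult_split)
    (simp add: linear_add[OF linear_hessian_left] linear_scale[OF linear_hessian_left])

text \<open>By compactness of the unit circle the form is at most \<open>- c\<close> there. At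
  distance parameter \<open>s\<close> along any unit direction \<open>\<zeta>\<close> the radial
  derivative is then at most \<open>- s * c / 2\<close>, uniformly in \<open>\<zeta>\<close>, so
  that \<open>r\<close> decreases along every ray from \<open>p\<close>.\<close>

lemma hessian_negative_imp_disc_direction:
  assumes v: "v \<noteq> 0" "dc v = 0" and neg: "\<And>\<zeta>. \<zeta> \<noteq> 0 \<Longrightarrow> H (\<zeta> *s v) (\<zeta> *s v) < 0"
  shows "disc_direction v"
proof -
  let ?d = "\<lambda>v z. frechet_derivative r (at z) v"
  have d0: "?d v p = 0" "?d (\<i> *s v) p = 0" using v by (simp_all add: dr_eq dc_vsmult)
  have cont: "continuous_on (sphere 0 1) (\<lambda>\<zeta>. H (\<zeta> *s v) (\<zeta> *s v))"
  proof -
    have eq: "H (\<zeta> *s v) (\<zeta> *s v) = Re \<zeta> * (Re \<zeta> * H v v + Im \<zeta> * H v (\<i> *s v)) +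
        Im \<zeta> * (Re \<zeta> * H (\<i> *s v) v + Im \<zeta> * H (\<i> *s v) (\<i> *s v))" for \<zeta>
      using hessian_vsmult_left[of \<zeta> v "\<zeta> *s v"] hessian_vsmult_right[of v \<zeta> v]
        hessian_vsmult_right[of "\<i> *s v" \<zeta> v] by (simp only:)
    show ?thesis by (rule continuous_on_eq[OF _ eq[symmetric]]) (intro continuous_intros)
  qed
  have "sphere (0::complex) 1 \<noteq> {}" using norm_one by (metis dist_0_norm empty_iff mem_sphere)
  then obtain \<zeta>0 where \<zeta>0: "\<zeta>0 \<in> sphere 0 1"
    "\<And>\<zeta>. \<zeta> \<in> sphere 0 1 \<Longrightarrow> H (\<zeta> *s v) (\<zeta> *s v) \<le> H (\<zeta>0 *s v) (\<zeta>0 *s v)"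
    using continuous_attains_sup[OF compact_sphere _ cont] by metis
  define c where "c = - H (\<zeta>0 *s v) (\<zeta>0 *s v)"
  have "\<zeta>0 \<noteq> 0" using \<zeta>0(1) by auto
  then have c: "c > 0" using neg[of \<zeta>0] by (simp add: c_def)
  define e where "e = c / (4 * norm v)"
  have e: "e > 0" "e * norm v = c / 4" using c v by (auto simp: e_def)
  \<comment> \<open>Expansions along \<open>v\<close> and \<open>\<i> *s v\<close> alone cover all
    directions \<open>\<zeta> *s v\<close> by real linearity. Each error is at most
    \<open>s * c / 4\<close>, so together they use up half of \<open>s * c\<close>.\<close>
  obtain \<delta>1 where \<delta>1: "\<delta>1 > 0" "ball p \<delta>1 \<subseteq> U"
    "\<And>x. norm x < \<delta>1 \<Longrightarrow> \<bar>?d v (p + x) - ?d v p - H x v\<bar> \<le> e * norm x"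
    using dr_expansion[OF e(1), of v] by metis
  obtain \<delta>2 where \<delta>2: "\<delta>2 > 0" "ball p \<delta>2 \<subseteq> U"
    "\<And>x. norm x < \<delta>2 \<Longrightarrow> \<bar>?d (\<i> *s v) (p + x) - ?d (\<i> *s v) p - H x (\<i> *s v)\<bar> \<le> e * norm x"
    using dr_expansion[OF e(1), of "\<i> *s v"] by metis
  define \<delta> where "\<delta> = min \<delta>1 \<delta>2 / (2 * norm v)"
  have \<delta>: "\<delta> > 0" using \<delta>1 \<delta>2 v by (simp add: \<delta>_def)
  have \<delta>v: "\<delta> * norm v < min \<delta>1 \<delta>2" using \<delta>1(1) \<delta>2(1) v by (simp add: \<delta>_def min_def)
  have neg': "?d (\<zeta> *s v) (p + s *\<^sub>R (\<zeta> *s v)) < 0" if \<zeta>: "norm \<zeta> = 1" and s: "0 < s" "s \<le> \<delta>" for \<zeta> s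
  proof -
    define x where "x = s *\<^sub>R (\<zeta> *s v)"
    have nx: "norm x = s * norm v" using \<zeta> s by (simp add: x_def norm_vsmult)
    have "s * norm v \<le> \<delta> * norm v" using s by (intro mult_right_mono) auto
    then have xb: "norm x < \<delta>1" "norm x < \<delta>2" using \<delta>v nx by auto
    have xU: "p + x \<in> U" using xb \<delta>1(2) by (auto simp: dist_norm)
    have en: "e * norm x = s * (c / 4)" unfolding nx e(2)[symmetric] by simp
    have E: "\<bar>?d v (p + x) - H x v\<bar> \<le> s * (c / 4)" "\<bar>?d (\<i> *s v) (p + x) - H x (\<i> *s v)\<bar> \<le> s * (c / 4)"
      using \<delta>1(3)[OF xb(1)] \<delta>2(3)[OF xb(2)] d0 en by simp_all
    have R: "\<bar>Re \<zeta>\<bar> \<le> 1" "\<bar>Im \<zeta>\<bar> \<le> 1" using \<zeta> abs_Re_le_cmod[of \<zeta>] abs_Im_le_cmod[of \<zeta>] by auto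
    have "\<bar>Re \<zeta> * (?d v (p + x) - H x v)\<bar> \<le> 1 * (s * (c / 4))"
      unfolding abs_mult using E R by (intro mult_mono) auto
    moreover have "\<bar>Im \<zeta> * (?d (\<i> *s v) (p + x) - H x (\<i> *s v))\<bar> \<le> 1 * (s * (c / 4))"
      unfolding abs_mult using E R by (intro mult_mono) auto
    moreover have "?d (\<zeta> *s v) (p + x) - H x (\<zeta> *s v) =
        Re \<zeta> * (?d v (p + x) - H x v) + Im \<zeta> * (?d (\<i> *s v) (p + x) - H x (\<i> *s v))"
      using dr_vsmult[OF xU, of \<zeta> v] hessian_vsmult_right[of x \<zeta> v] by (simp add: algebra_simps)
    ultimately have "?d (\<zeta> *s v) (p + x) \<le> H x (\<zeta> *s v) + s * (c / 2)" by linarith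
    also have "H x (\<zeta> *s v) = s * H (\<zeta> *s v) (\<zeta> *s v)"
      by (simp add: x_def linear_scale[OF linear_hessian_left])
    also have "\<dots> \<le> s * (- c)" using \<zeta>0(2)[of \<zeta>] \<zeta> s by (intro mult_left_mono) (auto simp: c_def)
    finally have "?d (\<zeta> *s v) (p + x) \<le> - (s * c) + s * c / 2" by simp
    also have "\<dots> < 0" using s(1) c by simp
    finally show ?thesis by (simp add: x_def)
  qed
  have "p + \<xi> *s v \<in> D" if "\<xi> \<noteq> 0" "norm \<xi> \<le> \<delta>" for \<xi>
  proof -
    have sU: "p + t *\<^sub>R (\<xi> *s v) \<in> U" if "0 \<le> t" "t \<le> 1" for t
    proof -
      have "t * norm \<xi> \<le> 1 * norm \<xi>" using that by (intro mult_right_mono) auto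
      then have "(t * norm \<xi>) * norm v \<le> \<delta> * norm v"
        using \<open>norm \<xi> \<le> \<delta>\<close> by (intro mult_right_mono) auto
      then have "norm (t *\<^sub>R (\<xi> *s v)) < \<delta>1" using \<delta>v that by (simp add: norm_vsmult mult.assoc)
      then show ?thesis using \<delta>1(2) by (auto simp: dist_norm)
    qed
    obtain t where t: "0 < t" "t < 1" "r (p + \<xi> *s v) - r p = ?d (\<xi> *s v) (p + t *\<^sub>R (\<xi> *s v))"
      by (rule segment_mvt[of r p "\<xi> *s v"]) (use sU diff_U in auto)
    define \<zeta> where "\<zeta> = sgn \<xi>"
    have \<xi>: "\<xi> *s v = norm \<xi> *\<^sub>R (\<zeta> *s v)"
      using \<open>\<xi> \<noteq> 0\<close> by (simp add: scaleR_eq_vsmult vector_smult_assoc \<zeta>_def sgn_eq)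
    have "?d (\<zeta> *s v) (p + (t * norm \<xi>) *\<^sub>R (\<zeta> *s v)) < 0"
    proof (rule neg')
      show "norm \<zeta> = 1" using \<open>\<xi> \<noteq> 0\<close> by (simp add: \<zeta>_def norm_sgn)
      show "t * norm \<xi> > 0" using t \<open>\<xi> \<noteq> 0\<close> by simp
      have "t * norm \<xi> \<le> 1 * norm \<xi>" using t by (intro mult_right_mono) auto
      then show "t * norm \<xi> \<le> \<delta>" using \<open>norm \<xi> \<le> \<delta>\<close> by simp
    qed
    moreover have "?d (\<xi> *s v) (p + t *\<^sub>R (\<xi> *s v)) = norm \<xi> * ?d (\<zeta> *s v) (p + (t * norm \<xi>) *\<^sub>R (\<zeta> *s v))"
      using sU[of t] t(1,2) unfolding \<xi> by (simp add: linear_scale linear_dr)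
    ultimately have "r (p + \<xi> *s v) < 0" using t(3) \<open>\<xi> \<noteq> 0\<close> by (simp add: r_p mult_less_0_iff)
    then show ?thesis using mem_D_iff sU[of 1] by simp
  qed
  then show ?thesis unfolding disc_direction_def using v \<delta> by blast
qed

text \<open>The mean value theorem is applied in direction \<open>Y\<close> to the increment of
  \<open>r\<close> along \<open>t *\<^sub>R X\<close>. This leaves a difference of first derivatives
  at two points near \<open>p\<close>, which differentiability at the single point \<open>p\<close>
  controls.\<close>

lemma second_difference:
  assumes "e > 0"
  obtains \<delta> where "\<delta> > 0"
    "\<And>t. 0 < t \<Longrightarrow> t < \<delta> \<Longrightarrow> \<bar>r (p + t *\<^sub>R X + t *\<^sub>R Y) - r (p + t *\<^sub>R X) - r (p + t *\<^sub>R Y) + r p - t\<^sup>2 * H X Y\<bar>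
       \<le> 2 * e * t\<^sup>2 * (norm X + norm Y)"
proof -
  let ?d = "\<lambda>v z. frechet_derivative r (at z) v"
  obtain \<delta> where \<delta>: "\<delta> > 0" "ball p \<delta> \<subseteq> U"
    "\<And>x. norm x < \<delta> \<Longrightarrow> \<bar>?d Y (p + x) - ?d Y p - H x Y\<bar> \<le> e * norm x"
    using dr_expansion[OF assms, of Y] by metis
  define M where "M = norm X + norm Y + 1"
  have M: "M > 0" "norm X + norm Y \<le> M" by (auto simp: M_def add_nonneg_pos)
  have "\<bar>r (p + t *\<^sub>R X + t *\<^sub>R Y) - r (p + t *\<^sub>R X) - r (p + t *\<^sub>R Y) + r p - t\<^sup>2 * H X Y\<bar>
       \<le> 2 * e * t\<^sup>2 * (norm X + norm Y)" if t: "0 < t" "t < \<delta> / M" for t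
  proof -
    have "t * (norm X + norm Y) \<le> t * M" using M t by (intro mult_left_mono) auto
    also have "t * M < \<delta>" using t M by (simp add: field_simps)
    finally have tb: "t * (norm X + norm Y) < \<delta>" .
    have nb: "norm (a *\<^sub>R X + b *\<^sub>R Y) \<le> t * (norm X + norm Y)" if "0 \<le> a" "a \<le> t" "0 \<le> b" "b \<le> t" for a b
    proof -
      have "norm (a *\<^sub>R X + b *\<^sub>R Y) \<le> a * norm X + b * norm Y"
        using norm_triangle_ineq[of "a *\<^sub>R X" "b *\<^sub>R Y"] that by simp
      also have "\<dots> \<le> t * norm X + t * norm Y" using that by (intro add_mono mult_right_mono) auto
      finally show ?thesis by (simp add: algebra_simps)
    qed
    have inU: "p + (a *\<^sub>R X + b *\<^sub>R Y) \<in> U" if "0 \<le> a" "a \<le> t" "0 \<le> b" "b \<le> t" for a b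
    proof -
      have "norm (a *\<^sub>R X + b *\<^sub>R Y) < \<delta>" using nb[OF that] tb by linarith
      moreover have "dist p (p + x) = norm x" for x :: "complex ^ 'n" by (simp add: dist_norm)
      ultimately show ?thesis using \<delta>(2) by (metis mem_ball subsetD)
    qed
    define F where "F = (\<lambda>z. r (z + t *\<^sub>R X) - r z)"
    have F: "(F has_derivative (\<lambda>h. ?d h (z + t *\<^sub>R X) - ?d h z)) (at z)"
      if "z \<in> U" "z + t *\<^sub>R X \<in> U" for z
    proof -
      have "(r has_derivative frechet_derivative r (at (z + t *\<^sub>R X))) (at (z + t *\<^sub>R X))"
        using diff_U[OF that(2)] by (simp add: frechet_derivative_works)
      moreover have "((\<lambda>z. z + t *\<^sub>R X) has_derivative (\<lambda>h. h)) (at z)"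
        by (auto intro!: derivative_eq_intros)
      ultimately have "((\<lambda>z. r (z + t *\<^sub>R X)) has_derivative (\<lambda>h. ?d h (z + t *\<^sub>R X))) (at z)"
        using has_derivative_compose by blast
      moreover have "(r has_derivative (\<lambda>h. ?d h z)) (at z)"
        using diff_U[OF that(1)] by (simp add: frechet_derivative_works)
      ultimately show ?thesis unfolding F_def by (rule has_derivative_diff)
    qed
    have seg: "p + s *\<^sub>R (t *\<^sub>R Y) \<in> U \<and> p + s *\<^sub>R (t *\<^sub>R Y) + t *\<^sub>R X \<in> U" if "0 \<le> s" "s \<le> 1" for s
      using inU[of 0 "s * t"] inU[of t "s * t"] that t
      by (simp add: mult_left_le_one_le add.assoc add.commute[of "t *\<^sub>R X"])
    obtain s where s: "0 < s" "s < 1"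
      "F (p + t *\<^sub>R Y) - F p = frechet_derivative F (at (p + s *\<^sub>R (t *\<^sub>R Y))) (t *\<^sub>R Y)"
      by (rule segment_mvt[of F p "t *\<^sub>R Y"]) (use F seg in \<open>auto simp: differentiable_def\<close>)
    define y where "y = p + s *\<^sub>R (t *\<^sub>R Y)"
    have yU: "y \<in> U" "y + t *\<^sub>R X \<in> U" using seg[of s] s by (auto simp: y_def)
    have "F (p + t *\<^sub>R Y) - F p = t * (?d Y (y + t *\<^sub>R X) - ?d Y y)"
      unfolding s(3) y_def[symmetric] frechet_derivative_at[OF F[OF yU], symmetric]
      by (simp add: linear_scale linear_dr yU algebra_simps)
    then have *: "r (p + t *\<^sub>R X + t *\<^sub>R Y) - r (p + t *\<^sub>R X) - r (p + t *\<^sub>R Y) + r p =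
      t * (?d Y (y + t *\<^sub>R X) - ?d Y y)"
      by (simp add: F_def algebra_simps)
    \<comment> \<open>The two evaluation points as increments from \<open>p\<close>. Their common
      \<open>Y\<close> part cancels in the difference of the Hessian terms.\<close>
    define x1 where "x1 = t *\<^sub>R X + (s * t) *\<^sub>R Y"
    define x2 where "x2 = 0 *\<^sub>R X + (s * t) *\<^sub>R Y"
    have st: "0 \<le> s * t" "s * t \<le> t" using s t by (auto simp: mult_left_le_one_le)
    have n1: "norm x1 \<le> t * (norm X + norm Y)" and n2: "norm x2 \<le> t * (norm X + norm Y)"
      unfolding x1_def x2_def by (rule nb; use st t in simp)+
    have "\<bar>?d Y (p + x1) - ?d Y p - H x1 Y\<bar> \<le> e * (t * (norm X + norm Y))"
      "\<bar>?d Y (p + x2) - ?d Y p - H x2 Y\<bar> \<le> e * (t * (norm X + norm Y))"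
    proof -
      have "norm x1 < \<delta>" "norm x2 < \<delta>" using n1 n2 tb by linarith+
      moreover have "e * norm x1 \<le> e * (t * (norm X + norm Y))" "e * norm x2 \<le> e * (t * (norm X + norm Y))"
        using n1 n2 assms by (auto intro: mult_left_mono)
      ultimately show "\<bar>?d Y (p + x1) - ?d Y p - H x1 Y\<bar> \<le> e * (t * (norm X + norm Y))"
        "\<bar>?d Y (p + x2) - ?d Y p - H x2 Y\<bar> \<le> e * (t * (norm X + norm Y))"
        using \<delta>(3) order_trans by blast+
    qed
    moreover have "p + x1 = y + t *\<^sub>R X" "p + x2 = y" by (simp_all add: x1_def x2_def y_def)
    moreover have "H x1 Y - H x2 Y = t * H X Y"
      by (simp add: x1_def x2_def linear_add[OF linear_hessian_left] linear_scale[OF linear_hessian_left])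
    ultimately have "\<bar>?d Y (y + t *\<^sub>R X) - ?d Y y - t * H X Y\<bar> \<le> 2 * (e * (t * (norm X + norm Y)))"
      by (simp only:)
    then have "t * \<bar>?d Y (y + t *\<^sub>R X) - ?d Y y - t * H X Y\<bar> \<le> t * (2 * (e * (t * (norm X + norm Y))))"
      using t by (intro mult_left_mono) auto
    moreover have "t * \<bar>?d Y (y + t *\<^sub>R X) - ?d Y y - t * H X Y\<bar> = \<bar>t * (?d Y (y + t *\<^sub>R X) - ?d Y y) - t\<^sup>2 * H X Y\<bar>"
    proof -
      have eq: "t * (?d Y (y + t *\<^sub>R X) - ?d Y y) - t\<^sup>2 * H X Y = t * (?d Y (y + t *\<^sub>R X) - ?d Y y - t * H X Y)"
        by (simp add: power2_eq_square algebra_simps)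
      show ?thesis unfolding eq abs_mult using t(1) by simp
    qed
    ultimately show ?thesis unfolding * by (simp add: power2_eq_square algebra_simps)
  qed
  moreover have "\<delta> / M > 0" using \<delta> M by simp
  ultimately show thesis using that by blast
qed

text \<open>The second difference is symmetric in \<open>X\<close> and \<open>Y\<close>, and
  \<open>t\<^sup>2\<close> times either mixed value approximates it. No continuity of second
  derivatives enters.\<close>

lemma hessian_symmetric: "H X Y = H Y X"
proof -
  have le: "\<bar>H X Y - H Y X\<bar> \<le> e * (4 * (norm X + norm Y))" if e: "e > 0" for e
  proof -
    obtain \<delta>1 where \<delta>1: "\<delta>1 > 0" and 1: "\<And>t. 0 < t \<Longrightarrow> t < \<delta>1 \<Longrightarrow>
        \<bar>r (p + t *\<^sub>R X + t *\<^sub>R Y) - r (p + t *\<^sub>R X) - r (p + t *\<^sub>R Y) + r p - t\<^sup>2 * H X Y\<bar>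
       \<le> 2 * e * t\<^sup>2 * (norm X + norm Y)"
      using second_difference[OF e, of X Y] by blast
    obtain \<delta>2 where \<delta>2: "\<delta>2 > 0" and 2: "\<And>t. 0 < t \<Longrightarrow> t < \<delta>2 \<Longrightarrow>
        \<bar>r (p + t *\<^sub>R Y + t *\<^sub>R X) - r (p + t *\<^sub>R Y) - r (p + t *\<^sub>R X) + r p - t\<^sup>2 * H Y X\<bar>
       \<le> 2 * e * t\<^sup>2 * (norm Y + norm X)"
      using second_difference[OF e, of Y X] by blast
    define t where "t = min \<delta>1 \<delta>2 / 2"
    have t: "0 < t" "t < \<delta>1" "t < \<delta>2" using \<delta>1 \<delta>2 by (auto simp: t_def)
    have "p + t *\<^sub>R Y + t *\<^sub>R X = p + t *\<^sub>R X + t *\<^sub>R Y" by (simp add: algebra_simps)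
    then have "\<bar>t\<^sup>2 * H X Y - t\<^sup>2 * H Y X\<bar> \<le> 2 * e * t\<^sup>2 * (norm X + norm Y) + 2 * e * t\<^sup>2 * (norm Y + norm X)"
      using 1[OF t(1,2)] 2[OF t(1,3)] by (simp only:)
    moreover have "\<bar>t\<^sup>2 * H X Y - t\<^sup>2 * H Y X\<bar> = t\<^sup>2 * \<bar>H X Y - H Y X\<bar>"
      by (simp add: right_diff_distrib[symmetric] abs_mult)
    moreover have "2 * e * t\<^sup>2 * (norm X + norm Y) + 2 * e * t\<^sup>2 * (norm Y + norm X) = t\<^sup>2 * (e * (4 * (norm X + norm Y)))"
      by (simp add: algebra_simps)
    ultimately have "t\<^sup>2 * \<bar>H X Y - H Y X\<bar> \<le> t\<^sup>2 * (e * (4 * (norm X + norm Y)))"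
      by (simp only:)
    then show ?thesis using t(1) by simp
  qed
  have "\<bar>H X Y - H Y X\<bar> = 0"
  proof (rule ccontr)
    assume "\<not> ?thesis"
    then have pos: "\<bar>H X Y - H Y X\<bar> > 0" by simp
    \<comment> \<open>With the error level \<open>a\<close> taken as the gap divided by
      \<open>M\<close>, the estimate would read \<open>a * M \<le> a * (M - 1)\<close>.\<close>
    define M where "M = 4 * (norm X + norm Y) + 1"
    have "M > 0" by (auto simp: M_def add_nonneg_pos)
    define a where "a = \<bar>H X Y - H Y X\<bar> / M"
    have a: "a > 0" "\<bar>H X Y - H Y X\<bar> = a * M" using pos \<open>M > 0\<close> by (simp_all add: a_def)
    then show False using le[OF a(1)] by (simp add: M_def algebra_simps)
  qed
  then show ?thesis by simp
qed

text \<open>At a point of the line \<open>r\<close> attains its maximum 0 along the tangent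
  direction \<open>Y\<close>, so its derivative in direction \<open>Y\<close> vanishes there.
  Differentiating this at \<open>p\<close> along \<open>X\<close> gives the claim, although
  \<open>r\<close> need not be twice differentiable at the other points.\<close>

lemma hessian_kernel:
  assumes max: "\<delta> > 0" "\<And>x. dc x = 0 \<Longrightarrow> norm x < \<delta> \<Longrightarrow> r (p + x) \<le> 0"
    and X: "dc X = 0" "\<And>t. norm (t *\<^sub>R X) < \<delta> \<Longrightarrow> r (p + t *\<^sub>R X) = 0"
    and Y: "dc Y = 0"
  shows "H X Y = 0"
proof -
  let ?d = "\<lambda>v z. frechet_derivative r (at z) v"
  have crit: "?d Y (p + x) = 0" if x: "x = t *\<^sub>R X" "norm x < \<delta>" "p + x \<in> U" for x t
  proof -
    define \<gamma> where "\<gamma> = (\<delta> - norm x) / (norm Y + 1)"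
    have nY: "norm Y + 1 > 0" by (rule add_nonneg_pos) auto
    have "(r has_derivative frechet_derivative r (at (p + x))) (at (p + x + 0 *\<^sub>R Y))"
      using diff_U[OF x(3)] by (simp add: frechet_derivative_works)
    moreover have "((\<lambda>s. p + x + s *\<^sub>R Y) has_derivative (\<lambda>s. s *\<^sub>R Y)) (at 0)"
      by (auto intro!: derivative_eq_intros)
    ultimately have "((\<lambda>s. r (p + x + s *\<^sub>R Y)) has_derivative (\<lambda>s. ?d (s *\<^sub>R Y) (p + x))) (at 0)"
      using has_derivative_compose[of "\<lambda>s. p + x + s *\<^sub>R Y" _ 0 UNIV r] by blast
    then have der: "((\<lambda>s. r (p + x + s *\<^sub>R Y)) has_field_derivative ?d Y (p + x)) (at 0)"
      by (simp add: has_field_derivative_def linear_scale[OF linear_dr[OF x(3)]] mult_commute_abs)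
    show ?thesis
    proof (rule DERIV_local_max[OF der])
      show "\<gamma> > 0" using x(2) nY by (simp add: \<gamma>_def)
      show "\<forall>s. \<bar>0 - s\<bar> < \<gamma> \<longrightarrow> r (p + x + s *\<^sub>R Y) \<le> r (p + x + 0 *\<^sub>R Y)"
      proof (intro allI impI)
        fix s :: real assume s: "\<bar>0 - s\<bar> < \<gamma>"
        have "\<bar>s\<bar> * norm Y \<le> \<bar>s\<bar> * (norm Y + 1)" by (intro mult_left_mono) auto
        also have "\<dots> < \<delta> - norm x" using s nY by (simp add: \<gamma>_def pos_less_divide_eq)
        finally have "norm (s *\<^sub>R Y) < \<delta> - norm x" by simp
        then have n: "norm (x + s *\<^sub>R Y) < \<delta>" using norm_triangle_ineq[of x "s *\<^sub>R Y"] by linarith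
        have "dc (x + s *\<^sub>R Y) = 0" using X(1) Y by (simp add: x(1) dc_add scaleR_eq_vsmult dc_vsmult)
        then have "r (p + (x + s *\<^sub>R Y)) \<le> 0" by (rule max(2)[OF _ n])
        moreover have "r (p + x) = 0" using X(2)[of t] x by simp
        ultimately show "r (p + x + s *\<^sub>R Y) \<le> r (p + x + 0 *\<^sub>R Y)" by (simp add: add.assoc)
      qed
    qed
  qed
  have le: "\<bar>H X Y\<bar> \<le> e * norm X" if e: "e > 0" for e
  proof -
    obtain \<delta>1 where \<delta>1: "\<delta>1 > 0" "ball p \<delta>1 \<subseteq> U"
      "\<And>x. norm x < \<delta>1 \<Longrightarrow> \<bar>?d Y (p + x) - ?d Y p - H x Y\<bar> \<le> e * norm x"
      using dr_expansion[OF e, of Y] by metis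
    define t where "t = min \<delta> \<delta>1 / (2 * (norm X + 1))"
    have nX: "norm X + 1 > 0" by (rule add_nonneg_pos) auto
    have t: "t > 0" using nX max(1) \<delta>1(1) by (simp add: t_def)
    have "t * norm X \<le> t * (norm X + 1)" using t by (intro mult_left_mono) auto
    also have "\<dots> = min \<delta> \<delta>1 / 2" using nX by (simp add: t_def field_simps)
    also have "\<dots> < min \<delta> \<delta>1" using max(1) \<delta>1(1) by (auto simp: min_def)
    finally have b: "norm (t *\<^sub>R X) < \<delta>" "norm (t *\<^sub>R X) < \<delta>1" using t by auto
    then have "p + t *\<^sub>R X \<in> U" using \<delta>1(2) by (auto simp: dist_norm)
    then have "?d Y (p + t *\<^sub>R X) = 0" using crit b by blast
    moreover have "?d Y p = 0" using Y by (simp add: dr_eq)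
    ultimately have "\<bar>H (t *\<^sub>R X) Y\<bar> \<le> e * norm (t *\<^sub>R X)" using \<delta>1(3)[OF b(2)] by simp
    then have "t * \<bar>H X Y\<bar> \<le> t * (e * norm X)"
      using t by (simp add: linear_scale[OF linear_hessian_left] abs_mult algebra_simps)
    then show ?thesis using t by simp
  qed
  have "\<bar>H X Y\<bar> \<le> 0"
  proof (rule field_le_epsilon)
    fix e :: real assume "e > 0"
    have nX: "norm X + 1 > 0" by (rule add_nonneg_pos) auto
    have "\<bar>H X Y\<bar> \<le> e / (norm X + 1) * norm X"
      using le[of "e / (norm X + 1)"] \<open>e > 0\<close> nX by simp
    also have "\<dots> \<le> e / (norm X + 1) * (norm X + 1)" using \<open>e > 0\<close> nX by (intro mult_left_mono) auto
    finally show "\<bar>H X Y\<bar> \<le> 0 + e" using nX by simp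
  qed
  then show ?thesis by simp
qed

text \<open>The sesquilinear part of the real Hessian; the factor 1/4 comes from the two halves in
  the Wirtinger derivatives. In this form the Levi form inherits the kernel of the Hessian.\<close>

definition levi_of_hessian :: "complex ^ 'n \<Rightarrow> complex ^ 'n \<Rightarrow> complex" where
  "levi_of_hessian X Y = (of_real (H X Y + H (\<i> *s X) (\<i> *s Y)) + \<i> * of_real (H X (\<i> *s Y) - H (\<i> *s X) Y)) / 4"

lemma levi_of_hessian_add: "levi_of_hessian (X + X') Y = levi_of_hessian X Y + levi_of_hessian X' Y" "levi_of_hessian X (Y + Y') = levi_of_hessian X Y + levi_of_hessian X Y'"
  by (simp_all add: levi_of_hessian_def vector_add_ldistrib linear_add[OF linear_hessian_left] linear_add[OF linear_hessian_right]
      algebra_simps add_divide_distrib diff_divide_distrib)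

lemma i_vsmult_split: "\<i> *s (c *s X) = Re c *\<^sub>R (\<i> *s X) - Im c *\<^sub>R (X :: complex ^ 'n)"
  by (simp add: vec_eq_iff complex_eq_iff)

lemma hessian_i_vsmult:
  "H (\<i> *s (c *s X)) Y = Re c * H (\<i> *s X) Y - Im c * H X Y"
  "H X (\<i> *s (c *s Y)) = Re c * H X (\<i> *s Y) - Im c * H X Y"
  by (simp_all only: i_vsmult_split linear_diff[OF linear_hessian_left] linear_diff[OF linear_hessian_right]
      linear_scale[OF linear_hessian_left] linear_scale[OF linear_hessian_right] real_scaleR_def)

lemma levi_of_hessian_vsmult: "levi_of_hessian (c *s X) Y = c * levi_of_hessian X Y" "levi_of_hessian X (c *s Y) = cnj c * levi_of_hessian X Y"
  unfolding levi_of_hessian_def hessian_i_vsmult hessian_vsmult_left[of c] hessian_vsmult_right[of _ c]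
  by (simp_all add: complex_eq_iff field_simps)

lemma levi_of_hessian_0: "levi_of_hessian 0 Y = 0" "levi_of_hessian X 0 = 0"
  using levi_of_hessian_vsmult(1)[of 0 0 Y] levi_of_hessian_vsmult(2)[of X 0 0] by simp_all

lemma levi_of_hessian_sum: "finite A \<Longrightarrow> levi_of_hessian (\<Sum>i\<in>A. f i) Y = (\<Sum>i\<in>A. levi_of_hessian (f i) Y)"
  "finite A \<Longrightarrow> levi_of_hessian X (\<Sum>i\<in>A. f i) = (\<Sum>i\<in>A. levi_of_hessian X (f i))"
  by (induction rule: finite_induct) (simp_all add: levi_of_hessian_add levi_of_hessian_0)

text \<open>On axis vectors the iterated Wirtinger derivatives give exactly the four terms of
  \<open>levi_of_hessian\<close>; sesquilinearity does the rest. The inner derivative has to be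
  known on a neighborhood of \<open>p\<close>, which C1 provides.\<close>

lemma levi_eq: "levi r p X Y = levi_of_hessian X Y"
proof -
  let ?d = "\<lambda>v z. frechet_derivative r (at z) v"
  have ax: "axis j \<i> = \<i> *s (axis j 1 :: complex ^ 'n)" for j
    by (simp add: vec_eq_iff axis_def)
  have wb: "wirtinger_bar k (\<lambda>z. of_real (r z)) z =
      (of_real (?d (axis k 1) z) + \<i> * of_real (?d (\<i> *s axis k 1) z)) / 2" if "z \<in> U" for k z
  proof -
    have "((\<lambda>z. complex_of_real (r z)) has_derivative (\<lambda>v. of_real (?d v z))) (at z)"
      using diff_U[OF that] unfolding frechet_derivative_works by (rule has_derivative_of_real)
    then have "frechet_derivative (\<lambda>z. complex_of_real (r z)) (at z) = (\<lambda>v. of_real (?d v z))"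
      by (metis frechet_derivative_at)
    then show ?thesis by (simp add: wirtinger_bar_def ax)
  qed
  have of_real_d: "((\<lambda>z. complex_of_real (?d Y z)) has_derivative (\<lambda>X. of_real (H X Y))) (at p)" for Y
    by (rule has_derivative_of_real[OF hessian_has_derivative])
  have "(wirtinger_bar k (\<lambda>z. of_real (r z)) has_derivative
      (\<lambda>X. (of_real (H X (axis k 1)) + \<i> * of_real (H X (\<i> *s axis k 1))) / 2)) (at p)" for k
  proof (rule has_derivative_transform_within_open[OF _ open_U p_U])
    show "((\<lambda>z. (of_real (?d (axis k 1) z) + \<i> * of_real (?d (\<i> *s axis k 1) z)) / 2) has_derivative
      (\<lambda>X. (of_real (H X (axis k 1)) + \<i> * of_real (H X (\<i> *s axis k 1))) / 2)) (at p)"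
      unfolding divide_inverse
      by (intro has_derivative_mult_left[OF has_derivative_add[OF of_real_d has_derivative_mult_right[OF of_real_d]]])
  qed (simp add: wb)
  then have fd: "frechet_derivative (wirtinger_bar k (\<lambda>z. of_real (r z))) (at p) =
      (\<lambda>X. (of_real (H X (axis k 1)) + \<i> * of_real (H X (\<i> *s axis k 1))) / 2)" for k
    by (rule frechet_derivative_at[symmetric])
  have w: "wirtinger j (wirtinger_bar k (\<lambda>z. of_real (r z))) p = levi_of_hessian (axis j 1) (axis k 1)" for j k
    unfolding wirtinger_def ax fd levi_of_hessian_def by (simp add: complex_eq_iff)
  have "levi_of_hessian X Y = levi_of_hessian (\<Sum>j\<in>UNIV. X $ j *s axis j 1) (\<Sum>k\<in>UNIV. Y $ k *s axis k 1)"
    by (simp only: basis_expansion)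
  also have "\<dots> = (\<Sum>j\<in>UNIV. \<Sum>k\<in>UNIV. levi_of_hessian (axis j 1) (axis k 1) * X $ j * cnj (Y $ k))"
    by (simp only: levi_of_hessian_sum finite levi_of_hessian_vsmult) (simp add: sum_distrib_left mult_ac, rule sum.swap)
  finally show ?thesis by (simp add: levi_def w)
qed

end

section \<open>Eigenvalues on a sum of two complex lines\<close>

text \<open>Orthogonality for this product implies real orthogonality of whole complex lines, so one
  orthogonal basis serves both kinds of eigenvalue counts.\<close>

definition hermitian_product :: "complex ^ 'n \<Rightarrow> complex ^ 'n \<Rightarrow> complex" where
  "hermitian_product x y = (\<Sum>j\<in>UNIV. x $ j * cnj (y $ j))"

lemma inner_eq_Re_hermitian_product: "x \<bullet> y = Re (hermitian_product x y)"
  by (simp add: hermitian_product_def inner_vec_def inner_complex_def)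

lemma hermitian_product_add:
  "hermitian_product (x + x') y = hermitian_product x y + hermitian_product x' y"
  "hermitian_product x (y + y') = hermitian_product x y + hermitian_product x y'"
  by (simp_all add: hermitian_product_def algebra_simps sum.distrib)

lemma hermitian_product_diff:
  "hermitian_product (x - x') y = hermitian_product x y - hermitian_product x' y"
  by (simp add: hermitian_product_def algebra_simps sum_subtractf)

lemma hermitian_product_vsmult:
  "hermitian_product (c *s x) y = c * hermitian_product x y"
  "hermitian_product x (c *s y) = cnj c * hermitian_product x y"
  by (simp_all add: hermitian_product_def sum_distrib_left mult_ac)

lemma hermitian_product_commute: "hermitian_product y x = cnj (hermitian_product x y)"
  by (simp add: hermitian_product_def mult.commute)

lemma hermitian_product_self: "hermitian_product x x = of_real ((norm x)\<^sup>2)"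
proof -
  have "Im (hermitian_product x x) = 0"
    by (simp add: hermitian_product_def)
  moreover have "Re (hermitian_product x x) = (norm x)\<^sup>2"
    using inner_eq_Re_hermitian_product[of x x] by (simp add: power2_norm_eq_inner)
  ultimately show ?thesis by (simp add: complex_eq_iff)
qed

lemma vec_dim_complex_line:
  fixes q :: "complex ^ 'n"
  assumes "q \<noteq> 0"
  shows "vec.dim (range (\<lambda>\<zeta>. \<zeta> *s q)) = 1"
proof -
  have "vec.independent {q}" using assms by (simp add: vec.dependent_single)
  then have "vec.dim (vec.span {q}) = 1" by (simp add: vec.dim_eq_card_independent)
  then show ?thesis by (simp add: vec.span_singleton)
qed

lemma linear_vsmult_left: "linear (\<lambda>\<zeta>. \<zeta> *s (u :: complex ^ 'n))"
  by (rule linearI) (simp_all add: vector_sadd_rdistrib scaleR_eq_vsmult scaleR_conv_of_real vector_smult_assoc)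

lemma inj_vsmult_left:
  fixes u :: "complex ^ 'n"
  assumes "u \<noteq> 0"
  shows "inj (\<lambda>\<zeta>. \<zeta> *s u)"
  using assms by (simp add: inj_def)

lemma dim_vsmult_image:
  fixes u :: "complex ^ 'n"
  assumes "u \<noteq> 0"
  shows "dim ((\<lambda>\<zeta>. \<zeta> *s u) ` A) = dim A"
  by (rule dim_image_eq[OF linear_vsmult_left]) (rule inj_on_subset[OF inj_vsmult_left[OF assms]], simp)

lemma dim_real_axis: "dim {\<zeta> :: complex. Im \<zeta> = 0} = 1"
proof -
  have "{\<zeta> :: complex. Im \<zeta> = 0} = span {1}"
    by (auto simp: span_singleton complex_eq_iff image_iff)
  then show ?thesis by (simp add: dim_eq_card_independent)
qed

lemma dim_imaginary_axis: "dim {\<zeta> :: complex. Re \<zeta> = 0} = 1"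
proof -
  have "{\<zeta> :: complex. Re \<zeta> = 0} = span {\<i>}"
    by (auto simp: span_singleton complex_eq_iff image_iff)
  then show ?thesis by (simp add: dim_eq_card_independent)
qed

context
  fixes B :: "complex ^ 'n \<Rightarrow> complex ^ 'n \<Rightarrow> real"
  assumes bil: "bilinear B" and sym: "\<And>x y. B x y = B y x"
begin

lemma form_vsmult:
  "B (c *s x) y = Re c * B x y + Im c * B (\<i> *s x) y"
  "B x (c *s y) = Re c * B x y + Im c * B x (\<i> *s y)"
  using vsmult_split[of c x] vsmult_split[of c y]
  by (simp_all add: bilinear_ladd[OF bil] bilinear_radd[OF bil] bilinear_lmul[OF bil] bilinear_rmul[OF bil])

lemma form_vsmult_self:
  "B (c *s x) (d *s x) = Re c * Re d * B x x + (Re c * Im d + Im c * Re d) * B x (\<i> *s x)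
     + Im c * Im d * B (\<i> *s x) (\<i> *s x)"
  unfolding form_vsmult(1)[of c x] form_vsmult(2)[of _ d x] by (simp add: sym[of "\<i> *s x" x] algebra_simps)

text \<open>A quarter turn changes the sign of the off-diagonal entry, so by the intermediate value
  theorem it vanishes at some angle in between.\<close>

lemma principal_axes_complex_line:
  obtains \<theta> where "B (cis \<theta> *s q) (\<i> *s (cis \<theta> *s q)) = 0"
proof -
  define g where "g = (\<lambda>\<theta>. B (cis \<theta> *s q) ((\<i> * cis \<theta>) *s q))"
  have g_eq: "g = (\<lambda>\<theta>. - (cos \<theta> * sin \<theta>) * B q q + (cos \<theta> * cos \<theta> - sin \<theta> * sin \<theta>) * B q (\<i> *s q)
     + sin \<theta> * cos \<theta> * B (\<i> *s q) (\<i> *s q))"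
    by (rule ext) (unfold g_def form_vsmult_self[of "cis \<theta>" q "\<i> * cis \<theta>" for \<theta>], simp)
  have cont: "continuous_on {0..pi/2} g" unfolding g_eq by (intro continuous_intros)
  have "g (pi / 2) = - g 0" by (simp add: g_eq)
  then consider "g 0 \<le> 0" "0 \<le> g (pi / 2)" | "g (pi / 2) \<le> 0" "0 \<le> g 0" by linarith
  then have "\<exists>\<theta>. g \<theta> = 0"
  proof cases
    case 1 then show ?thesis using IVT'[of g 0 0 "pi / 2"] cont by auto
  next
    case 2 then show ?thesis using IVT2'[of g "pi / 2" 0 0] cont by auto
  qed
  then show thesis using that by (auto simp: g_def vector_smult_assoc)
qed

lemma num_neg_eigenvalues_principal_axes:
  assumes u: "u \<noteq> 0" and axes: "B u (\<i> *s u) = 0"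
  shows "num_neg_eigenvalues B (range (\<lambda>\<zeta>. \<zeta> *s u)) =
    (if B u u < 0 then 1 else 0) + (if B (\<i> *s u) (\<i> *s u) < 0 then 1 else 0)"
proof -
  define N where "N = (norm u)\<^sup>2"
  have N: "N > 0" using u by (simp add: N_def)
  define a where "a = B u u / N"
  define b where "b = B (\<i> *s u) (\<i> *s u) / N"
  \<comment> \<open>Eigenspaces in the coordinate \<open>\<zeta>\<close>: a coordinate may be
    nonzero exactly when \<open>\<mu>\<close> equals the diagonal entry belonging to it. This also
    covers \<open>a = b\<close>.\<close>
  let ?A = "\<lambda>\<mu>. {\<zeta>. (Re \<zeta> = 0 \<or> \<mu> = a) \<and> (Im \<zeta> = 0 \<or> \<mu> = b)}"
  have ip: "(c *s u) \<bullet> (d *s u) = (Re c * Re d + Im c * Im d) * N" for c d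
    by (simp add: inner_eq_Re_hermitian_product hermitian_product_vsmult hermitian_product_self N_def algebra_simps)
  have form: "B (c *s u) (d *s u) = (Re c * Re d * a + Im c * Im d * b) * N" for c d
    using N unfolding form_vsmult_self[of c u d] axes by (simp add: a_def b_def distrib_right)
  have "(\<forall>d. B (c *s u) (d *s u) = \<mu> * ((c *s u) \<bullet> (d *s u))) \<longleftrightarrow> c \<in> ?A \<mu>" for c \<mu>
  proof -
    have "(B (c *s u) (d *s u) = \<mu> * ((c *s u) \<bullet> (d *s u))) \<longleftrightarrow>
        Re c * (a - \<mu>) * Re d + Im c * (b - \<mu>) * Im d = 0" for d
    proof -
      have "B (c *s u) (d *s u) - \<mu> * ((c *s u) \<bullet> (d *s u)) =
          (Re c * (a - \<mu>) * Re d + Im c * (b - \<mu>) * Im d) * N"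
        unfolding ip form by (simp add: algebra_simps)
      then show ?thesis using N by (metis eq_iff_diff_eq_0 mult_eq_0_iff less_irrefl)
    qed
    moreover have "(\<forall>d. Re c * (a - \<mu>) * Re d + Im c * (b - \<mu>) * Im d = 0) \<longleftrightarrow>
        Re c * (a - \<mu>) = 0 \<and> Im c * (b - \<mu>) = 0"
    proof
      assume *: "\<forall>d. Re c * (a - \<mu>) * Re d + Im c * (b - \<mu>) * Im d = 0"
      show "Re c * (a - \<mu>) = 0 \<and> Im c * (b - \<mu>) = 0" using *[rule_format, of 1] *[rule_format, of \<i>] by simp
    qed auto
    ultimately show ?thesis by auto
  qed
  then have E: "real_eigenspace B (range (\<lambda>\<zeta>. \<zeta> *s u)) \<mu> = (\<lambda>\<zeta>. \<zeta> *s u) ` ?A \<mu>" for \<mu>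
    unfolding real_eigenspace_def by blast
  have dimA: "dim (?A \<mu>) = (if \<mu> = a then 1 else 0) + (if \<mu> = b then 1 else 0)" for \<mu>
  proof -
    have "{\<zeta> :: complex. Re \<zeta> = 0 \<and> Im \<zeta> = 0} = {0}" by (auto simp: complex_eq_iff)
    then show ?thesis by (auto simp: dim_real_axis dim_imaginary_axis)
  qed
  have dimE: "dim (real_eigenspace B (range (\<lambda>\<zeta>. \<zeta> *s u)) \<mu>) =
      (if \<mu> = a then 1 else 0) + (if \<mu> = b then 1 else 0)" for \<mu>
    unfolding E dim_vsmult_image[OF u] dimA ..
  have E0: "real_eigenspace B (range (\<lambda>\<zeta>. \<zeta> *s u)) \<mu> \<noteq> {0} \<longleftrightarrow> \<mu> = a \<or> \<mu> = b" for \<mu>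
  proof
    assume "\<mu> = a \<or> \<mu> = b"
    then have "dim (real_eigenspace B (range (\<lambda>\<zeta>. \<zeta> *s u)) \<mu>) \<noteq> 0" unfolding dimE by auto
    then show "real_eigenspace B (range (\<lambda>\<zeta>. \<zeta> *s u)) \<mu> \<noteq> {0}" by auto
  next
    assume *: "real_eigenspace B (range (\<lambda>\<zeta>. \<zeta> *s u)) \<mu> \<noteq> {0}"
    show "\<mu> = a \<or> \<mu> = b"
    proof (rule ccontr)
      assume "\<not> (\<mu> = a \<or> \<mu> = b)"
      then have "?A \<mu> = {0}" by (auto simp: complex_eq_iff)
      then show False using * unfolding E by simp
    qed
  qed
  have "num_neg_eigenvalues B (range (\<lambda>\<zeta>. \<zeta> *s u)) =
      (\<Sum>\<mu> | \<mu> < 0 \<and> (\<mu> = a \<or> \<mu> = b). (if \<mu> = a then 1 else 0) + (if \<mu> = b then 1 else 0))"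
    unfolding num_neg_eigenvalues_def E0 dimE ..
  also have "{\<mu>. \<mu> < 0 \<and> (\<mu> = a \<or> \<mu> = b)} = {\<mu> \<in> {a, b}. \<mu> < 0}" by auto
  also have "(\<Sum>\<mu> \<in> {\<mu> \<in> {a, b}. \<mu> < 0}. (if \<mu> = a then 1 else 0) + (if \<mu> = b then 1 else 0)) =
      (\<Sum>\<mu>\<in>{a, b}. if \<mu> < 0 then (if \<mu> = a then 1 else 0) + (if \<mu> = b then 1 else 0) else (0::nat))"
    by (rule sum.inter_filter) simp
  \<comment> \<open>If \<open>a = b\<close>, the sum has a single term, which then counts 2.\<close>
  also have "\<dots> = (if a < 0 then 1 else 0) + (if b < 0 then 1 else 0)"
    by (cases "a = b") auto
  finally show ?thesis using N by (simp add: a_def b_def divide_less_0_iff)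
qed

text \<open>Links the count with negative definiteness, after a rotation of \<open>q\<close> to
  principal axes that leaves the line unchanged. One direction reads the hypothesis on the Hessian,
  the other yields the count on the tangent hyperplane.\<close>

lemma num_neg_eigenvalues_complex_line:
  assumes q: "q \<noteq> 0"
  shows "num_neg_eigenvalues B (range (\<lambda>\<zeta>. \<zeta> *s q)) = 2 \<longleftrightarrow> (\<forall>\<zeta>. \<zeta> \<noteq> 0 \<longrightarrow> B (\<zeta> *s q) (\<zeta> *s q) < 0)"
proof -
  obtain \<theta> where axes: "B (cis \<theta> *s q) (\<i> *s (cis \<theta> *s q)) = 0"
    using principal_axes_complex_line by blast
  define u where "u = cis \<theta> *s q"
  have u: "u \<noteq> 0" using q by (simp add: u_def)
  have qu: "q = cis (- \<theta>) *s u" by (simp add: u_def vector_smult_assoc cis_mult)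
  have range_eq: "range (\<lambda>\<zeta>. \<zeta> *s q) = range (\<lambda>\<zeta>. \<zeta> *s u)"
  proof
    show "range (\<lambda>\<zeta>. \<zeta> *s q) \<subseteq> range (\<lambda>\<zeta>. \<zeta> *s u)"
      by (subst qu) (auto simp: vector_smult_assoc)
    show "range (\<lambda>\<zeta>. \<zeta> *s u) \<subseteq> range (\<lambda>\<zeta>. \<zeta> *s q)"
      by (auto simp: u_def vector_smult_assoc)
  qed
  have "(\<forall>\<zeta>. \<zeta> \<noteq> 0 \<longrightarrow> B (\<zeta> *s q) (\<zeta> *s q) < 0) \<longleftrightarrow> (\<forall>\<zeta>. \<zeta> \<noteq> 0 \<longrightarrow> B (\<zeta> *s u) (\<zeta> *s u) < 0)"
  proof -
    have "(\<forall>x\<in>range (\<lambda>\<zeta>. \<zeta> *s y). x \<noteq> 0 \<longrightarrow> B x x < 0) \<longleftrightarrow> (\<forall>\<zeta>. \<zeta> \<noteq> 0 \<longrightarrow> B (\<zeta> *s y) (\<zeta> *s y) < 0)"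
      if "y \<noteq> 0" for y using that by auto
    then show ?thesis using q u range_eq by metis
  qed
  also have "\<dots> \<longleftrightarrow> B u u < 0 \<and> B (\<i> *s u) (\<i> *s u) < 0"
  proof
    assume *: "\<forall>\<zeta>. \<zeta> \<noteq> 0 \<longrightarrow> B (\<zeta> *s u) (\<zeta> *s u) < 0"
    show "B u u < 0 \<and> B (\<i> *s u) (\<i> *s u) < 0" using *[rule_format, of 1] *[rule_format, of \<i>] by simp
  next
    assume neg: "B u u < 0 \<and> B (\<i> *s u) (\<i> *s u) < 0"
    show "\<forall>\<zeta>. \<zeta> \<noteq> 0 \<longrightarrow> B (\<zeta> *s u) (\<zeta> *s u) < 0"
    proof (intro allI impI)
      fix \<zeta> :: complex assume "\<zeta> \<noteq> 0"
      then have "Re \<zeta> * Re \<zeta> > 0 \<or> Im \<zeta> * Im \<zeta> > 0" by (auto simp: complex_eq_iff zero_less_mult_iff)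
      then have "Re \<zeta> * Re \<zeta> * B u u < 0 \<or> Im \<zeta> * Im \<zeta> * B (\<i> *s u) (\<i> *s u) < 0"
        using neg mult_pos_neg by blast
      moreover have "Re \<zeta> * Re \<zeta> * B u u \<le> 0" "Im \<zeta> * Im \<zeta> * B (\<i> *s u) (\<i> *s u) \<le> 0"
        using neg by (simp_all add: mult_nonneg_nonpos)
      ultimately have "Re \<zeta> * Re \<zeta> * B u u + Im \<zeta> * Im \<zeta> * B (\<i> *s u) (\<i> *s u) < 0" by linarith
      then show "B (\<zeta> *s u) (\<zeta> *s u) < 0"
        unfolding form_vsmult_self[of \<zeta> u \<zeta>] using axes by (simp add: u_def)
    qed
  qed
  finally show ?thesis
    unfolding range_eq num_neg_eigenvalues_principal_axes[OF u axes[folded u_def]] by auto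
qed

context
  fixes q w :: "complex ^ 'n" and T :: "(complex ^ 'n) set"
  assumes q: "q \<noteq> 0" and w: "w \<noteq> 0" and orth: "hermitian_product q w = 0"
    and T: "T = {\<zeta> *s q + \<xi> *s w | \<zeta> \<xi>. True}"
    and ker: "\<And>\<xi> y. y \<in> T \<Longrightarrow> B (\<xi> *s w) y = 0"
begin

lemma lines_in_T: "\<zeta> *s q \<in> T" "\<xi> *s w \<in> T"
proof -
  have "\<zeta> *s q + 0 *s w \<in> T" "0 *s q + \<xi> *s w \<in> T" unfolding T by blast+
  then show "\<zeta> *s q \<in> T" "\<xi> *s w \<in> T" by simp_all
qed

text \<open>An eigenvector for a nonzero eigenvalue is orthogonal to the kernel. Tested against its
  own component along \<open>w\<close>, it shows that this component is zero.\<close>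

lemma real_eigenspace_split:
  assumes "\<mu> < 0"
  shows "real_eigenspace B T \<mu> = real_eigenspace B (range (\<lambda>\<zeta>. \<zeta> *s q)) \<mu>"
proof -
  have ip: "(\<zeta> *s q) \<bullet> (\<xi> *s w) = 0" for \<zeta> \<xi>
    by (simp add: inner_eq_Re_hermitian_product hermitian_product_vsmult orth)
  show ?thesis
  proof (intro equalityI subsetI)
    fix x assume x: "x \<in> real_eigenspace B T \<mu>"
    then obtain \<zeta> \<xi> where x_eq: "x = \<zeta> *s q + \<xi> *s w" by (auto simp: real_eigenspace_def T)
    have eig: "B x y = \<mu> * (x \<bullet> y)" if "y \<in> T" for y using x that by (auto simp: real_eigenspace_def)
    have "x \<in> T" using x by (simp add: real_eigenspace_def)
    then have "0 = \<mu> * (x \<bullet> (\<xi> *s w))" using eig[OF lines_in_T(2), of \<xi>] ker[of x \<xi>] sym by metis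
    then have "x \<bullet> (\<xi> *s w) = 0" using assms by simp
    then have "\<xi> *s w = 0" unfolding x_eq by (simp add: inner_add_left ip)
    then have "x = \<zeta> *s q" by (simp add: x_eq)
    then have "x \<in> range (\<lambda>\<zeta>. \<zeta> *s q)" by blast
    then show "x \<in> real_eigenspace B (range (\<lambda>\<zeta>. \<zeta> *s q)) \<mu>"
      using eig lines_in_T(1) unfolding real_eigenspace_def by blast
  next
    fix x assume x: "x \<in> real_eigenspace B (range (\<lambda>\<zeta>. \<zeta> *s q)) \<mu>"
    then obtain \<zeta> where x_eq: "x = \<zeta> *s q" by (auto simp: real_eigenspace_def)
    have "B x y = \<mu> * (x \<bullet> y)" if yT: "y \<in> T" for y
    proof -
      obtain \<zeta>' \<xi>' where y: "y = \<zeta>' *s q + \<xi>' *s w" using yT by (auto simp: T)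
      have "B x (\<xi>' *s w) = 0" using ker[OF lines_in_T(1)] sym x_eq by metis
      moreover have "B x (\<zeta>' *s q) = \<mu> * (x \<bullet> (\<zeta>' *s q))" using x by (auto simp: real_eigenspace_def)
      ultimately show ?thesis
        unfolding y by (simp add: bilinear_radd[OF bil] inner_add_right ip x_eq)
    qed
    then show "x \<in> real_eigenspace B T \<mu>" using lines_in_T(1) by (auto simp: real_eigenspace_def x_eq)
  qed
qed

lemma num_neg_eigenvalues_split:
  "num_neg_eigenvalues B T = num_neg_eigenvalues B (range (\<lambda>\<zeta>. \<zeta> *s q))"
  unfolding num_neg_eigenvalues_def using real_eigenspace_split by (intro sum.cong) auto

text \<open>Testing a kernel vector against its own \<open>q\<close> component, definiteness removes
  that component. What remains is the complex line of \<open>w\<close>, of real dimension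
  two.\<close>

lemma num_zero_eigenvalues_split:
  assumes neg: "\<And>\<zeta>. \<zeta> \<noteq> 0 \<Longrightarrow> B (\<zeta> *s q) (\<zeta> *s q) < 0"
  shows "num_zero_eigenvalues B T = 2"
proof -
  have "real_eigenspace B T 0 = range (\<lambda>\<xi>. \<xi> *s w)"
  proof (intro equalityI subsetI)
    fix x assume x: "x \<in> real_eigenspace B T 0"
    then obtain \<zeta> \<xi> where x_eq: "x = \<zeta> *s q + \<xi> *s w" by (auto simp: real_eigenspace_def T)
    have "B x (\<zeta> *s q) = 0" using x lines_in_T(1) by (auto simp: real_eigenspace_def)
    then have "B (\<zeta> *s q) (\<zeta> *s q) = 0"
      unfolding x_eq using ker[OF lines_in_T(1)] by (simp add: bilinear_ladd[OF bil])
    then have "\<zeta> = 0" using neg[of \<zeta>] by (cases "\<zeta> = 0") auto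
    then have "x = \<xi> *s w" by (simp add: x_eq)
    then show "x \<in> range (\<lambda>\<xi>. \<xi> *s w)" by blast
  next
    fix x assume "x \<in> range (\<lambda>\<xi>. \<xi> *s w)"
    then show "x \<in> real_eigenspace B T 0" using ker lines_in_T(2) by (auto simp: real_eigenspace_def)
  qed
  moreover have "dim (UNIV :: complex set) = 2" by simp
  ultimately show ?thesis by (simp add: num_zero_eigenvalues_def dim_vsmult_image[OF w])
qed

end

end

text \<open>In the orthogonal basis \<open>q\<close>, \<open>w\<close> the form is diagonal with
  entries \<open>m\<close> and 0. As \<open>q\<close> is not normalised, the negative eigenvalue is
  \<open>m / (norm q)\<^sup>2\<close>.\<close>

lemma herm_eigenvalues_split:
  fixes L :: "complex ^ 'n \<Rightarrow> complex ^ 'n \<Rightarrow> complex"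
  assumes q: "q \<noteq> 0" and w: "w \<noteq> 0" and orth: "hermitian_product q w = 0"
    and T: "T = {\<zeta> *s q + \<xi> *s w | \<zeta> \<xi>. True}"
    and L: "\<And>\<zeta> \<xi> \<zeta>' \<xi>'. L (\<zeta> *s q + \<xi> *s w) (\<zeta>' *s q + \<xi>' *s w) = \<zeta> * cnj \<zeta>' * of_real m"
    and m: "m < 0"
  shows "num_neg_herm_eigenvalues L T = 1" "num_zero_herm_eigenvalues L T = 1"
proof -
  define a where "a = m / (norm q)\<^sup>2"
  have a: "a < 0" using m q by (simp add: a_def divide_neg_pos)
  have wq: "hermitian_product w q = 0" using orth hermitian_product_commute[of w q] by simp
  let ?A = "\<lambda>\<mu>. {\<zeta> *s q + \<xi> *s w | \<zeta> \<xi>. (\<zeta> = 0 \<or> \<mu> = a) \<and> (\<xi> = 0 \<or> \<mu> = 0)}"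
  have hp: "hermitian_product (\<zeta> *s q + \<xi> *s w) (\<zeta>' *s q + \<xi>' *s w) =
      \<zeta> * cnj \<zeta>' * of_real ((norm q)\<^sup>2) + \<xi> * cnj \<xi>' * of_real ((norm w)\<^sup>2)" for \<zeta> \<xi> \<zeta>' \<xi>'
    by (simp add: hermitian_product_add hermitian_product_vsmult hermitian_product_self orth wq)
  have nz: "complex_of_real ((norm q)\<^sup>2) \<noteq> 0" "complex_of_real ((norm w)\<^sup>2) \<noteq> 0" using q w by simp_all
  have eig: "(\<forall>y\<in>T. L (\<zeta> *s q + \<xi> *s w) y = of_real \<mu> * hermitian_product (\<zeta> *s q + \<xi> *s w) y) \<longleftrightarrow>
      (\<zeta> = 0 \<or> \<mu> = a) \<and> (\<xi> = 0 \<or> \<mu> = 0)" for \<zeta> \<xi> \<mu>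
  proof
    assume *: "\<forall>y\<in>T. L (\<zeta> *s q + \<xi> *s w) y = of_real \<mu> * hermitian_product (\<zeta> *s q + \<xi> *s w) y"
    have **: "\<zeta> * cnj \<zeta>' * of_real m =
       of_real \<mu> * (\<zeta> * cnj \<zeta>' * of_real ((norm q)\<^sup>2) + \<xi> * cnj \<xi>' * of_real ((norm w)\<^sup>2))" for \<zeta>' \<xi>'
    proof -
      have "\<zeta>' *s q + \<xi>' *s w \<in> T" unfolding T by blast
      then show ?thesis using * unfolding L[symmetric, of \<zeta> \<zeta>' \<xi> \<xi>'] hp[symmetric] by blast
    qed
    have "\<zeta> = 0 \<or> \<mu> = a"
    proof (cases "\<zeta> = 0")
      case False
      then have "complex_of_real m = of_real (\<mu> * (norm q)\<^sup>2)" using **[of 1 0] by simp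
      then have "m = \<mu> * (norm q)\<^sup>2" by (simp only: of_real_eq_iff)
      then show ?thesis using q by (simp add: a_def)
    qed simp
    moreover have "\<xi> = 0 \<or> \<mu> = 0" using **[of 0 1] nz by auto
    ultimately show "(\<zeta> = 0 \<or> \<mu> = a) \<and> (\<xi> = 0 \<or> \<mu> = 0)" by simp
  next
    assume *: "(\<zeta> = 0 \<or> \<mu> = a) \<and> (\<xi> = 0 \<or> \<mu> = 0)"
    have m_eq: "m = a * (norm q)\<^sup>2" using q by (simp add: a_def)
    show "\<forall>y\<in>T. L (\<zeta> *s q + \<xi> *s w) y = of_real \<mu> * hermitian_product (\<zeta> *s q + \<xi> *s w) y"
    proof
      fix y assume "y \<in> T"
      then obtain \<zeta>' \<xi>' where y: "y = \<zeta>' *s q + \<xi>' *s w" by (auto simp: T)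
      show "L (\<zeta> *s q + \<xi> *s w) y = of_real \<mu> * hermitian_product (\<zeta> *s q + \<xi> *s w) y"
        unfolding y L hp m_eq using * by auto
    qed
  qed
  have E: "herm_eigenspace L T \<mu> = ?A \<mu>" for \<mu>
  proof (rule set_eqI)
    fix x
    have "x \<in> herm_eigenspace L T \<mu> \<longleftrightarrow> (\<exists>\<zeta> \<xi>. x = \<zeta> *s q + \<xi> *s w \<and>
        (\<forall>y\<in>T. L (\<zeta> *s q + \<xi> *s w) y = of_real \<mu> * hermitian_product (\<zeta> *s q + \<xi> *s w) y))"
      unfolding herm_eigenspace_def hermitian_product_def[symmetric]
      by (subst (1) T) auto
    then show "x \<in> herm_eigenspace L T \<mu> \<longleftrightarrow> x \<in> ?A \<mu>" unfolding eig by blast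
  qed
  have Aa: "?A a = range (\<lambda>\<zeta>. \<zeta> *s q)" using a by auto
  have A0: "?A 0 = range (\<lambda>\<xi>. \<xi> *s w)" using a by auto
  have Ae: "?A \<mu> = {0}" if "\<mu> \<noteq> a" "\<mu> \<noteq> 0" for \<mu> using that by auto
  show "num_zero_herm_eigenvalues L T = 1"
    unfolding num_zero_herm_eigenvalues_def E A0 by (rule vec_dim_complex_line[OF w])
  have dim_a: "vec.dim (herm_eigenspace L T a) = 1"
    unfolding E Aa by (rule vec_dim_complex_line[OF q])
  have "range (\<lambda>\<zeta>. \<zeta> *s q) \<noteq> {0}"
  proof
    assume "range (\<lambda>\<zeta>. \<zeta> *s q) = {0}"
    then have "1 *s q = 0" by blast
    then show False using q by simp
  qed
  then have "{\<mu>. \<mu> < 0 \<and> herm_eigenspace L T \<mu> \<noteq> {0}} = {a}"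
    using a Aa Ae unfolding E by auto
  then show "num_neg_herm_eigenvalues L T = 1"
    unfolding num_neg_herm_eigenvalues_def using dim_a by simp
qed

section \<open>Complex lines in the tangent hyperplane\<close>

lemma directions_translate:
  assumes "vec.subspace V"
  shows "directions ((\<lambda>v. a + v) ` V) = V"
proof
  show "directions ((\<lambda>v. a + v) ` V) \<subseteq> V"
    using vec.subspace_diff[OF assms] by (auto simp: directions_def)
  show "V \<subseteq> directions ((\<lambda>v. a + v) ` V)"
  proof
    fix x assume "x \<in> V"
    moreover have "x = (a + x) - (a + 0)" by simp
    ultimately show "x \<in> directions ((\<lambda>v. a + v) ` V)"
      using vec.subspace_0[OF assms] unfolding directions_def by blast
  qed
qed

lemma directions_complex_line:
  fixes L :: "(complex ^ 'n) set"
  assumes "complex_line L"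
  obtains v where "v \<noteq> 0" "directions L = range (\<lambda>\<zeta>. \<zeta> *s v)"
proof -
  obtain a V where V: "vec.subspace V" "vec.dim V = 1" "L = (\<lambda>v. a + v) ` V"
    using assms by (auto simp: complex_affine_def)
  obtain B where B: "B \<subseteq> V" "vec.independent B" "V \<subseteq> vec.span B" "card B = 1"
    using vec.basis_exists[of V] V(2) by metis
  then obtain v where v: "B = {v}" by (auto simp: card_1_singleton_iff)
  have "vec.span B = V" using B(1,3) vec.span_minimal[OF B(1) V(1)] by auto
  then have "directions L = range (\<lambda>\<zeta>. \<zeta> *s v)"
    using directions_translate[OF V(1)] by (simp add: V(3) v vec.span_singleton)
  moreover have "v \<noteq> 0" using B(2) v by (auto simp: vec.dependent_single)
  ultimately show thesis using that by blast
qed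

lemma complex_line_range:
  fixes w :: "complex ^ 'n"
  assumes "w \<noteq> 0"
  shows "complex_line (range (\<lambda>\<zeta>. a + \<zeta> *s w))"
    "directions (range (\<lambda>\<zeta>. a + \<zeta> *s w)) = range (\<lambda>\<zeta>. \<zeta> *s w)"
proof -
  have sub: "vec.subspace (range (\<lambda>\<zeta>. \<zeta> *s w))"
    using vec.subspace_span[of "{w}"] by (simp add: vec.span_singleton)
  have eq: "range (\<lambda>\<zeta>. a + \<zeta> *s w) = (\<lambda>v. a + v) ` range (\<lambda>\<zeta>. \<zeta> *s w)"
    by (simp add: image_image)
  show "complex_line (range (\<lambda>\<zeta>. a + \<zeta> *s w))"
    unfolding complex_affine_def using sub vec_dim_complex_line[OF assms] eq by blast
  show "directions (range (\<lambda>\<zeta>. a + \<zeta> *s w)) = range (\<lambda>\<zeta>. \<zeta> *s w)"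
    unfolding eq by (rule directions_translate[OF sub])
qed

lemma complex_affine_line_mem:
  assumes "complex_affine k P" "x \<in> P" "y \<in> P"
  shows "x + c *s (y - x) \<in> P"
proof -
  obtain a V where V: "vec.subspace V" "P = (\<lambda>v. a + v) ` V"
    using assms(1) by (auto simp: complex_affine_def)
  then obtain x' y' where xy: "x' \<in> V" "x = a + x'" "y' \<in> V" "y = a + y'" using assms by auto
  have "x' + c *s (y' - x') \<in> V"
    using V(1) xy by (intro vec.subspace_add vec.subspace_scale vec.subspace_diff)
  moreover have "x + c *s (y - x) = a + (x' + c *s (y' - x'))" by (simp add: xy add.assoc)
  ultimately show ?thesis unfolding V(2) by blast
qed

lemma (in boundary_point) directions_complex_tangent:
  "directions (complex_tangent r p) = {x. dc x = 0}"
proof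
  show "directions (complex_tangent r p) \<subseteq> {x. dc x = 0}"
  proof
    fix x assume "x \<in> directions (complex_tangent r p)"
    then obtain y z where "dc (y - p) = 0" "dc (z - p) = 0" "x = y - z"
      by (auto simp: directions_def complex_tangent_eq)
    then show "x \<in> {x. dc x = 0}" using dc_diff[of "y - p" "z - p"] by simp
  qed
  show "{x. dc x = 0} \<subseteq> directions (complex_tangent r p)"
  proof
    fix x assume "x \<in> {x. dc x = 0}"
    then have "p + x \<in> complex_tangent r p" "p \<in> complex_tangent r p"
      by (simp_all add: complex_tangent_eq dc_0)
    moreover have "x = (p + x) - p" by simp
    ultimately show "x \<in> directions (complex_tangent r p)" unfolding directions_def by blast
  qed
qed

text \<open>Small vectors of the span have small coefficients. This converts the polydisc of
  coefficients in \<open>tangent_slice\<close> into a ball about \<open>p\<close>.\<close>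

lemma vsmult_pair_bounded_below:
  fixes v w :: "complex ^ 'n"
  assumes indep: "\<And>s t. s *s v + t *s w = 0 \<Longrightarrow> s = 0 \<and> t = 0"
  obtains \<beta> where "\<beta> > 0" "\<And>s t. \<beta> * norm s \<le> norm (s *s v + t *s w)"
    "\<And>s t. \<beta> * norm t \<le> norm (s *s v + t *s w)"
proof -
  let ?f = "\<lambda>(s, t). s *s v + t *s w"
  have lin: "linear ?f"
    by (rule linearI)
      (auto simp: vector_sadd_rdistrib scaleR_eq_vsmult scaleR_conv_of_real vector_smult_assoc vector_add_ldistrib)
  then have "inj ?f"
    unfolding linear_injective_0[OF lin] using indep by (auto simp: zero_prod_def)
  then obtain \<beta> where \<beta>: "\<beta> > 0" "\<And>x. \<beta> * norm x \<le> norm (?f x)"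
    using linear_inj_bounded_below_pos[OF lin] by blast
  show thesis
  proof (rule that[OF \<beta>(1)])
    fix s t :: complex
    have "\<beta> * norm s \<le> \<beta> * norm (s, t)" "\<beta> * norm t \<le> \<beta> * norm (s, t)"
      using \<beta>(1) norm_fst_le[of "s" t] norm_snd_le[of t s] by (auto intro!: mult_left_mono)
    then show "\<beta> * norm s \<le> norm (s *s v + t *s w)" "\<beta> * norm t \<le> norm (s *s v + t *s w)"
      using \<beta>(2)[of "(s, t)"] by auto
  qed
qed

theorem proposition4:
  fixes D U :: "(complex ^ 3) set" and p :: "complex ^ 3" and r :: "complex ^ 3 \<Rightarrow> real"
  assumes "open D" and "p \<in> frontier D"
    and "p \<in> U" and "C1_defining_function r U D"
    and "frechet_derivative r (at p) \<noteq> (\<lambda>v. 0)"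
    and "twice_differentiable_at r p"
    and "\<exists>L. complex_line L \<and> L \<subseteq> complex_tangent r p \<and>
           num_neg_eigenvalues (hessian r p) (directions L) = 2"
    and "S D \<noteq> UNIV"
  shows "\<exists>l. complex_line l \<and> p \<in> l \<and>
    (subset_near p (complex_tangent r p - l) D \<and>
     subset_near p l (frontier D) \<and>
     UNIV - l \<subseteq> S D) \<and>
    ((\<forall>b. b \<notin> l \<or> b = p \<longrightarrow>
        (\<exists>P. complex_plane P \<and> p \<in> P \<and> b \<in> P \<and> \<not> pseudoconvex_in_plane P (P \<inter> D))) \<and>
     p \<in> S D \<and>
     (\<forall>b\<in>l. b \<noteq> p \<longrightarrow>
        \<not> (\<exists>P. complex_plane P \<and> p \<in> P \<and> b \<in> P \<and> \<not> pseudoconvex_in_plane P (P \<inter> D)))) \<and>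
    ((\<forall>X\<in>directions l. hessian r p X X = 0) \<and>
     (\<forall>X\<in>directions l. levi r p X X = 0) \<and>
     num_neg_eigenvalues (hessian r p) (directions (complex_tangent r p)) = 2 \<and>
     num_zero_eigenvalues (hessian r p) (directions (complex_tangent r p)) = 2 \<and>
     num_neg_herm_eigenvalues (levi r p) (directions (complex_tangent r p)) = 1 \<and>
     num_zero_herm_eigenvalues (levi r p) (directions (complex_tangent r p)) = 1)"
proof -
  interpret twice_differentiable_boundary_point D U p r
    using assms(1-6) by unfold_locales

  \<comment> \<open>A disc direction from the Hessian hypothesis\<close>
  obtain L where L: "complex_line L" "L \<subseteq> complex_tangent r p" "num_neg_eigenvalues H (directions L) = 2"
    using assms(7) by blast
  obtain v where v: "v \<noteq> 0" "directions L = range (\<lambda>\<zeta>. \<zeta> *s v)"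
    using directions_complex_line[OF L(1)] by blast
  have "1 *s v \<in> directions L" unfolding v(2) by blast
  moreover have "directions L \<subseteq> directions (complex_tangent r p)"
    using L(2) by (auto simp: directions_def)
  ultimately have dc_v: "dc v = 0" unfolding directions_complex_tangent by auto
  have v_neg: "H (\<zeta> *s v) (\<zeta> *s v) < 0" if "\<zeta> \<noteq> 0" for \<zeta>
    using num_neg_eigenvalues_complex_line[OF bilinear_hessian hessian_symmetric v(1)] L(3) v(2) that by auto
  have disc_v: "disc_direction v" by (rule hessian_negative_imp_disc_direction[OF v(1) dc_v v_neg])

  \<comment> \<open>A point outside \<open>S D\<close> and a basis of the tangent directions\<close>
  obtain a where a: "a \<notin> S D" using assms(8) by auto
  define w where "w = a - p"
  have a_eq: "a = p + w" by (simp add: w_def)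
  have through_a: "\<not> (dc (a - p) \<noteq> 0 \<or> (\<exists>\<zeta>. a = p + \<zeta> *s v))"
    using nonpseudoconvex_plane_through[OF disc_v] a unfolding S_def by blast
  then have dc_w: "dc w = 0" and wv: "\<And>\<zeta>. w \<noteq> \<zeta> *s v" by (auto simp: a_eq)
  have w0: "w \<noteq> 0" using wv[of 0] by simp
  have indep: "s = 0 \<and> t = 0" if "s *s v + t *s w = 0" for s t
  proof (cases "t = 0")
    case True then show ?thesis using that v(1) by simp
  next
    case False
    have "t *s w = - (s *s v)" using that by (metis add.commute eq_neg_iff_add_eq_0)
    then have "(1 / t) *s (t *s w) = (1 / t) *s (- (s *s v))" by simp
    then have "w = (- s / t) *s v" using False by (simp add: vector_smult_assoc vector_smult_rneg vector_smult_lneg)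
    then show ?thesis using wv by blast
  qed
  obtain n where n: "dc n = 1" using normal_exists by blast
  \<comment> \<open>Dimension three enters here: \<open>v\<close>, \<open>w\<close>,
    \<open>n\<close> form a basis, and the coefficient of \<open>n\<close> in \<open>x\<close> is
    \<open>dc x = 0\<close>.\<close>
  have span: "\<exists>s t. x = s *s v + t *s w" if x: "dc x = 0" for x
  proof -
    have dc_span: "dc y = 0" if "y \<in> vec.span {v, w}" for y
      using that dc_v dc_w unfolding vec_span_pair by (auto simp: dc_add dc_vsmult)
    then have nspan: "n \<notin> vec.span {v, w}" using n by force
    then have ind: "vec.independent (insert n {v, w})"
      by (simp only: vec.independent_insert vec_independent_pair(1)[of v w, OF indep]) simp
    have "n \<notin> {v, w}" using nspan vec.span_base by blast
    then have "card (insert n {v, w}) = 3" using vec_independent_pair(2)[of v w, OF indep] by simp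
    then have "UNIV \<subseteq> vec.span (insert n {v, w})"
      using vec.card_ge_dim_independent[OF _ ind, of UNIV] by (simp add: vec_dim_card del: vec.dim_UNIV)
    then obtain k where k: "x - k *s n \<in> vec.span {v, w}" unfolding vec.span_insert by blast
    then have "k = 0" using dc_span[OF k] x by (simp add: dc_diff dc_vsmult n)
    then have "x \<in> vec.span {v, w}" using k by simp
    then show ?thesis unfolding vec_span_pair by blast
  qed

  \<comment> \<open>The line \<open>l\<close> and the tangential slice of \<open>D\<close> near
    \<open>p\<close>\<close>
  define l where "l = range (\<lambda>\<zeta>. p + \<zeta> *s w)"
  have line_l: "complex_line l" and dir_l: "directions l = range (\<lambda>\<zeta>. \<zeta> *s w)"
    unfolding l_def by (rule complex_line_range[OF w0])+
  have p_l: "p \<in> l" unfolding l_def by (rule range_eqI[of _ _ 0]) simp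
  have l_iff: "p + (s *s v + t *s w) \<in> l \<longleftrightarrow> s = 0" for s t
  proof
    assume "p + (s *s v + t *s w) \<in> l"
    then obtain \<zeta> where "p + (s *s v + t *s w) = p + \<zeta> *s w" unfolding l_def by blast
    then have "s *s v + (t - \<zeta>) *s w = 0" by (simp add: vec.scale_left_diff_distrib add_diff_eq)
    then show "s = 0" using indep by blast
  qed (auto simp: l_def)

  have a': "p + w \<notin> S D" using a a_eq by simp
  obtain \<delta> where \<delta>: "\<delta> > 0"
    "\<And>z1 z2. norm z1 < \<delta> \<Longrightarrow> norm z2 < \<delta> \<Longrightarrow> p + z1 *s v + z2 *s w \<in> D \<longleftrightarrow> z1 \<noteq> 0"
    using tangent_slice[OF a' disc_v dc_w indep] by blast
  obtain \<beta> where \<beta>: "\<beta> > 0" "\<And>s t. \<beta> * norm s \<le> norm (s *s v + t *s w)"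
    "\<And>s t. \<beta> * norm t \<le> norm (s *s v + t *s w)"
    using vsmult_pair_bounded_below[OF indep] by blast
  obtain \<delta>' where \<delta>': "\<delta>' > 0" "ball p \<delta>' \<subseteq> U" using open_U p_U open_contains_ball by blast
  \<comment> \<open>The first bound makes both coefficients smaller than \<open>\<delta>\<close>;
    the second keeps \<open>r\<close> available.\<close>
  define \<kappa> where "\<kappa> = min (\<beta> * \<delta>) \<delta>'"
  have \<kappa>: "\<kappa> > 0" using \<beta> \<delta> \<delta>' by (simp add: \<kappa>_def)
  have slice: "p + x \<in> D \<longleftrightarrow> p + x \<notin> l" if x: "dc x = 0" "norm x < \<kappa>" for x
  proof -
    obtain s t where st: "x = s *s v + t *s w" using span[OF x(1)] by blast
    have "\<beta> * norm s < \<beta> * \<delta>" "\<beta> * norm t < \<beta> * \<delta>"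
      using \<beta>(2)[of s t] \<beta>(3)[of t s] x(2) unfolding st \<kappa>_def by linarith+
    then have "norm s < \<delta>" "norm t < \<delta>" using \<beta>(1) by simp_all
    then have "p + s *s v + t *s w \<in> D \<longleftrightarrow> s \<noteq> 0" by (rule \<delta>(2))
    then show ?thesis unfolding st l_iff by (simp add: add.assoc)
  qed
  have dist_p: "dist p (p + x) = norm x" for x by (simp add: dist_norm)
  have xU: "p + x \<in> U" if "norm x < \<kappa>" for x
  proof -
    have "p + x \<in> ball p \<delta>'" using that by (simp add: \<kappa>_def dist_p)
    then show ?thesis using \<delta>'(2) by blast
  qed
  have dc_l: "dc x = 0" if "p + x \<in> l" for x
    using that by (auto simp: l_def dc_vsmult dc_w)

  \<comment> \<open>Statement (i): the local position of the tangent hyperplane\<close>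
  have tangent_minus_l: "subset_near p (complex_tangent r p - l) D"
    unfolding subset_near_def
  proof (intro exI conjI subsetI)
    fix z assume z: "z \<in> (complex_tangent r p - l) \<inter> ball p \<kappa>"
    define x where "x = z - p"
    have "dc x = 0" "norm x < \<kappa>" "p + x = z"
      using z by (auto simp: complex_tangent_eq x_def dist_norm norm_minus_commute)
    then show "z \<in> D" using slice[of x] z by auto
  qed (use \<kappa> in auto)

  have frontier_l: "p + x \<in> frontier D" if x: "p + x \<in> l" "norm x < \<kappa>" for x
  proof -
    have "p + x \<in> closure D"
      unfolding closure_approachable
    proof (intro allI impI)
      fix e :: real assume e: "e > 0"
      \<comment> \<open>The points approaching \<open>p + x\<close> are moved off \<open>l\<close>
        along \<open>v\<close>, by less than \<open>e\<close> and without leaving the radius in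
        which \<open>slice\<close> applies.\<close>
      define m where "m = min e (\<kappa> - norm x)"
      have m: "m > 0" using e x(2) by (simp add: m_def)
      define s where "s = m / (2 * norm v)"
      have s: "s > 0" using m v(1) by (simp add: s_def)
      have "norm (of_real s *s v) = s * norm v" using s by (simp add: norm_vsmult)
      also have "\<dots> < m" using m v(1) by (simp add: s_def)
      finally have sv: "norm (of_real s *s v) < m" .
      obtain t where "p + x = p + t *s w" using x(1) unfolding l_def by blast
      then have t: "x = t *s w" by simp
      have "norm (of_real s *s v + x) < \<kappa>"
        using norm_triangle_ineq[of "of_real s *s v" x] sv by (simp add: m_def)
      moreover have "dc (of_real s *s v + x) = 0" using dc_v dc_l[OF x(1)] by (simp add: dc_add dc_vsmult)
      moreover have "p + (of_real s *s v + x) \<notin> l" using l_iff[of "of_real s" t] s by (simp add: t)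
      ultimately have "p + (of_real s *s v + x) \<in> D" using slice by blast
      moreover have "dist (p + (of_real s *s v + x)) (p + x) < e"
        using sv by (simp add: dist_norm m_def)
      ultimately show "\<exists>y\<in>D. dist y (p + x) < e" by blast
    qed
    moreover have "p + x \<notin> D" using slice[OF dc_l[OF x(1)] x(2)] x(1) by blast
    ultimately show ?thesis using open_D by (simp add: frontier_def interior_open)
  qed
  have l_frontier: "subset_near p l (frontier D)"
    unfolding subset_near_def
  proof (intro exI conjI subsetI)
    fix z assume z: "z \<in> l \<inter> ball p \<kappa>"
    have "p + (z - p) = z" "norm (z - p) < \<kappa>" using z by (auto simp: dist_norm norm_minus_commute)
    then show "z \<in> frontier D" using frontier_l[of "z - p"] z by auto
  qed (use \<kappa> in auto)

  \<comment> \<open>Statement (ii): planes through \<open>p\<close> and a given point\<close>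
  have plane: "\<exists>P. complex_plane P \<and> p \<in> P \<and> b \<in> P \<and> \<not> pseudoconvex_in_plane P (P \<inter> D)"
    if b: "b \<notin> l \<or> b = p" for b
  proof (cases "b = p")
    case True
    then have "b = p + 0 *s v" by simp
    then show ?thesis using nonpseudoconvex_plane_through[OF disc_v] by blast
  next
    case bp: False
    show ?thesis
    proof (cases "dc (b - p) = 0")
      case False then show ?thesis using nonpseudoconvex_plane_through[OF disc_v] by blast
    next
      case True
      \<comment> \<open>For tangent \<open>b\<close> off \<open>l\<close>, the direction to
        \<open>b\<close> is itself a disc direction by \<open>slice\<close>, so it can replace
        \<open>v\<close>.\<close>
      define u where "u = b - p"
      have u: "dc u = 0" "u \<noteq> 0" "b = p + u" using True bp by (auto simp: u_def)
      have "disc_direction u" unfolding disc_direction_def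
      proof (intro conjI exI[of _ "\<kappa> / (2 * norm u)"] allI impI)
        show "\<kappa> / (2 * norm u) > 0" using \<kappa> u by simp
        fix \<zeta> :: complex assume \<zeta>: "\<zeta> \<noteq> 0" "norm \<zeta> \<le> \<kappa> / (2 * norm u)"
        have "norm (\<zeta> *s u) \<le> \<kappa> / (2 * norm u) * norm u"
          unfolding norm_vsmult using \<zeta>(2) by (rule mult_right_mono) simp
        also have "\<dots> < \<kappa>" using u(2) \<kappa> by simp
        finally have "norm (\<zeta> *s u) < \<kappa>" .
        moreover have "p + \<zeta> *s u \<notin> l"
        proof
          assume "p + \<zeta> *s u \<in> l"
          then obtain \<xi> where "p + \<zeta> *s u = p + \<xi> *s w" unfolding l_def by blast
          then have "(1 / \<zeta>) *s (\<zeta> *s u) = (1 / \<zeta>) *s (\<xi> *s w)" by simp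
          then have "u = (\<xi> / \<zeta>) *s w" using \<zeta>(1) by (simp add: vector_smult_assoc)
          then have "b \<in> l" using u(3) by (auto simp: l_def)
          then show False using b bp by blast
        qed
        ultimately show "p + \<zeta> *s u \<in> D" using slice[of "\<zeta> *s u"] u(1) by (simp add: dc_vsmult)
      qed (use u in auto)
      moreover have "b = p + 1 *s u" using u(3) by simp
      ultimately show ?thesis using nonpseudoconvex_plane_through by blast
    qed
  qed
  then have outside: "b \<in> S D" if "b \<notin> l \<or> b = p" for b
    using that unfolding S_def by blast
  have no_plane: "\<not> (\<exists>P. complex_plane P \<and> p \<in> P \<and> b \<in> P \<and> \<not> pseudoconvex_in_plane P (P \<inter> D))"
    if b: "b \<in> l" "b \<noteq> p" for b
  proof
    assume "\<exists>P. complex_plane P \<and> p \<in> P \<and> b \<in> P \<and> \<not> pseudoconvex_in_plane P (P \<inter> D)"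
    then obtain P where P: "complex_plane P" "p \<in> P" "b \<in> P" "\<not> pseudoconvex_in_plane P (P \<inter> D)" by blast
    obtain \<xi> where \<xi>: "b = p + \<xi> *s w" using b(1) unfolding l_def by blast
    then have "\<xi> \<noteq> 0" using b(2) by auto
    \<comment> \<open>A plane containing two points of \<open>l\<close> contains \<open>l\<close>
      and hence \<open>a\<close>; a non-pseudoconvex section would contradict
      \<open>a \<notin> S D\<close>.\<close>
    then have "p + (1 / \<xi>) *s (b - p) = a" by (simp add: \<xi> a_eq vector_smult_assoc)
    then have "a \<in> P" using complex_affine_line_mem[OF P(1-3), of "1 / \<xi>"] by simp
    then show False using a P unfolding S_def by blast
  qed

  \<comment> \<open>Statement (iii): the kernel and the eigenvalue counts\<close>
  have ker: "H (\<xi> *s w) Y = 0" if "dc Y = 0" for \<xi> Y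
  proof (rule hessian_kernel[OF \<kappa> _ _ _ that])
    have on_l: "r (p + x) = 0" if "p + x \<in> l" "norm x < \<kappa>" for x
      using frontier_l[OF that] frontier_D_iff[OF xU[OF that(2)]] by blast
    show "r (p + x) \<le> 0" if "dc x = 0" "norm x < \<kappa>" for x
      using slice[OF that] on_l[OF _ that(2)] mem_D_iff[OF xU[OF that(2)]] by (cases "p + x \<in> l") auto
    show "dc (\<xi> *s w) = 0" by (simp add: dc_vsmult dc_w)
    show "r (p + t *\<^sub>R (\<xi> *s w)) = 0" if "norm (t *\<^sub>R (\<xi> *s w)) < \<kappa>" for t
    proof (rule on_l[OF _ that])
      have "p + t *\<^sub>R (\<xi> *s w) = p + (of_real t * \<xi>) *s w"
        by (simp add: scaleR_eq_vsmult vector_smult_assoc)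
      then show "p + t *\<^sub>R (\<xi> *s w) \<in> l" unfolding l_def by blast
    qed
  qed
  \<comment> \<open>The kernel is complex: both tangent directions and multiples of \<open>w\<close>
    are stable under \<open>\<i>\<close>, so all four Hessian terms vanish.\<close>
  have ker_levi: "levi_of_hessian (\<xi> *s w) Y = 0" "levi_of_hessian Y (\<xi> *s w) = 0" if Y: "dc Y = 0" for \<xi> Y
  proof -
    have 1: "H (\<xi>' *s w) Y = 0" "H (\<xi>' *s w) (\<i> *s Y) = 0" "H Y (\<xi>' *s w) = 0" "H (\<i> *s Y) (\<xi>' *s w) = 0" for \<xi>'
      using ker[of Y \<xi>'] ker[of "\<i> *s Y" \<xi>'] Y hessian_symmetric by (auto simp: dc_vsmult)
    show "levi_of_hessian (\<xi> *s w) Y = 0" "levi_of_hessian Y (\<xi> *s w) = 0"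
      using 1[of \<xi>] 1[of "\<i> * \<xi>"] by (simp_all add: levi_of_hessian_def vector_smult_assoc)
  qed

  \<comment> \<open>Eigenvalues depend on the inner product and \<open>v\<close> need not be
    orthogonal to \<open>w\<close>, so its projection off \<open>w\<close> is used instead.\<close>
  define q where "q = v - (hermitian_product v w / hermitian_product w w) *s w"
  have "hermitian_product w w \<noteq> 0" using w0 by (simp add: hermitian_product_self)
  then have orth: "hermitian_product q w = 0"
    by (simp add: q_def hermitian_product_diff hermitian_product_vsmult)
  define k where "k = hermitian_product v w / hermitian_product w w"
  have vq: "v = q + k *s w" by (simp add: q_def k_def)
  have q0: "q \<noteq> 0"
  proof
    assume "q = 0"
    then have "1 *s v + (- k) *s w = 0" using vq by (simp add: vector_smult_lneg)
    then show False using indep by fastforce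
  qed
  have dc_q: "dc q = 0" by (simp add: q_def dc_diff dc_vsmult dc_v dc_w)
  define T where "T = directions (complex_tangent r p)"
  have T_dc: "T = {x. dc x = 0}" by (simp add: T_def directions_complex_tangent)
  have T_eq: "T = {\<zeta> *s q + \<xi> *s w | \<zeta> \<xi>. True}"
  proof
    show "{\<zeta> *s q + \<xi> *s w | \<zeta> \<xi>. True} \<subseteq> T" by (auto simp: T_dc dc_add dc_vsmult dc_q dc_w)
    show "T \<subseteq> {\<zeta> *s q + \<xi> *s w | \<zeta> \<xi>. True}"
    proof
      fix x assume "x \<in> T"
      then have "dc x = 0" by (simp add: T_dc)
      then obtain s t where "x = s *s v + t *s w" using span by blast
      also have "s *s v + t *s w = s *s q + (s * k + t) *s w"
        by (subst vq) (simp add: vector_add_ldistrib vector_sadd_rdistrib vector_smult_assoc add.assoc)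
      finally have "x = s *s q + (s * k + t) *s w" .
      then show "x \<in> {\<zeta> *s q + \<xi> *s w | \<zeta> \<xi>. True}" by blast
    qed
  qed
  \<comment> \<open>Replacing \<open>v\<close> by \<open>q\<close> alters it by a kernel vector,
    which leaves the quadratic form unchanged.\<close>
  have q_neg: "H (\<zeta> *s q) (\<zeta> *s q) < 0" if "\<zeta> \<noteq> 0" for \<zeta>
  proof -
    define \<xi> where "\<xi> = \<zeta> * k"
    have "\<zeta> *s v = \<zeta> *s q + \<xi> *s w"
      unfolding \<xi>_def by (subst vq) (simp add: vector_add_ldistrib vector_smult_assoc)
    then have "H (\<zeta> *s v) (\<zeta> *s v) = H (\<zeta> *s q) (\<zeta> *s q) + H (\<zeta> *s q) (\<xi> *s w) + H (\<xi> *s w) (\<zeta> *s q + \<xi> *s w)"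
      by (simp only: bilinear_ladd[OF bilinear_hessian] bilinear_radd[OF bilinear_hessian])
    also have "\<dots> = H (\<zeta> *s q) (\<zeta> *s q)"
      using ker[of "\<zeta> *s q" \<xi>] ker[of "\<zeta> *s q + \<xi> *s w" \<xi>] hessian_symmetric[of "\<zeta> *s q" "\<xi> *s w"]
      by (simp add: dc_add dc_vsmult dc_q dc_w)
    finally show ?thesis using v_neg[OF that] by simp
  qed
  have kerT: "H (\<xi> *s w) y = 0" if "y \<in> T" for \<xi> y
    using that ker unfolding T_dc by blast
  have "num_neg_eigenvalues H (range (\<lambda>\<zeta>. \<zeta> *s q)) = 2"
    by (rule num_neg_eigenvalues_complex_line[OF bilinear_hessian hessian_symmetric q0, THEN iffD2])
      (simp add: q_neg)
  then have "num_neg_eigenvalues H T = 2"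
    using num_neg_eigenvalues_split[OF bilinear_hessian hessian_symmetric q0 w0 orth T_eq kerT] by simp
  then have eig1: "num_neg_eigenvalues H (directions (complex_tangent r p)) = 2" unfolding T_def .
  have "num_zero_eigenvalues H T = 2"
    by (rule num_zero_eigenvalues_split[OF bilinear_hessian hessian_symmetric q0 w0 orth T_eq kerT q_neg])
  then have eig2: "num_zero_eigenvalues H (directions (complex_tangent r p)) = 2" unfolding T_def .
  have eig3: "num_neg_herm_eigenvalues (levi r p) (directions (complex_tangent r p)) = 1"
    "num_zero_herm_eigenvalues (levi r p) (directions (complex_tangent r p)) = 1"
  proof -
    define m where "m = (H q q + H (\<i> *s q) (\<i> *s q)) / 4"
    have m: "m < 0" using q_neg[of 1] q_neg[of \<i>] by (simp add: m_def)
    have Gq: "levi_of_hessian q q = of_real m"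
      by (simp add: levi_of_hessian_def m_def hessian_symmetric[of "\<i> *s q" q])
    have "levi r p (\<zeta> *s q + \<xi> *s w) (\<zeta>' *s q + \<xi>' *s w) = \<zeta> * cnj \<zeta>' * of_real m" for \<zeta> \<xi> \<zeta>' \<xi>'
    proof -
      have "dc (\<zeta>' *s q + \<xi>' *s w) = 0" by (simp add: dc_add dc_vsmult dc_q dc_w)
      then have "levi r p (\<zeta> *s q + \<xi> *s w) (\<zeta>' *s q + \<xi>' *s w) = levi_of_hessian (\<zeta> *s q) (\<zeta>' *s q + \<xi>' *s w)"
        by (simp add: levi_eq levi_of_hessian_add(1) ker_levi(1))
      also have "\<dots> = levi_of_hessian (\<zeta> *s q) (\<zeta>' *s q)"
        by (simp add: levi_of_hessian_add(2) ker_levi(2) dc_vsmult dc_q)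
      finally show ?thesis by (simp add: levi_of_hessian_vsmult Gq)
    qed
    note split = herm_eigenvalues_split[OF q0 w0 orth T_eq this m, unfolded T_def]
    show "num_neg_herm_eigenvalues (levi r p) (directions (complex_tangent r p)) = 1" by (rule split(1))
    show "num_zero_herm_eigenvalues (levi r p) (directions (complex_tangent r p)) = 1" by (rule split(2))
  qed
  have vanish: "\<forall>X\<in>directions l. H X X = 0" "\<forall>X\<in>directions l. levi r p X X = 0"
    unfolding dir_l using ker ker_levi(1) by (auto simp: levi_eq dc_vsmult dc_w)
  have planes: "\<forall>b. b \<notin> l \<or> b = p \<longrightarrow>
      (\<exists>P. complex_plane P \<and> p \<in> P \<and> b \<in> P \<and> \<not> pseudoconvex_in_plane P (P \<inter> D))"
    using plane by (intro allI impI)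
  have no_planes: "\<forall>b\<in>l. b \<noteq> p \<longrightarrow>
      \<not> (\<exists>P. complex_plane P \<and> p \<in> P \<and> b \<in> P \<and> \<not> pseudoconvex_in_plane P (P \<inter> D))"
    using no_plane by (intro ballI impI)
  have S: "UNIV - l \<subseteq> S D" "p \<in> S D" using outside by auto
  show ?thesis
    by (intro exI[of _ l] conjI line_l p_l tangent_minus_l l_frontier S planes no_planes vanish eig1 eig2 eig3)
qed

end
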